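(* Distributional chaos of type 3 with respect to $f^2$ does not imply distributional chaos of type 3 with respect to $f$. That is, there exist a non-empty compact metric space $(X,d)$ and a continuous map $f:X\to X$ such that there is a pair of points of $X$ that is distributionally chaotic of type 3 with respect to $f^2=f\circ f$, but no pair of points of $X$ is distributionally chaotic of type 3 with respect to $f$.
   Context: Let $(X,d)$ be a non-empty compact metric space and $g:X\to X$ a continuous map. For $(x_1,x_2)\in X^2$ and $\delta>0$, the lower and upper distribution functions generated by $g$ are $$\Phi_{(x_1,x_2)}(\delta)=\liminf_{m\to\infty}\frac1m\#\{0\le k\le m:\ d(g^k(x_1),g^k(x_2))<\delta\},$$ $$\Phi^*_{(x_1,x_2)}(\delta)=\limsup_{m\to\infty}\frac1m\#\{0\le k\le m:\ d(g^k(x_1),g^k(x_2))<\delta\},$$ where $g^k$ is the $k$-th iterate of $g$ and $\#A$ is the cardinality of $A$. The pair $(x_1,x_2)$ is distributionally chaotic of type 3 (DC3) with respect to $g$ if there are real numbers $0\le a<b\le\operatorname{diam}X$ such that $\Phi_{(x_1,x_2)}(\delta)<\Phi^*_{(x_1,x_2)}(\delta)$ for every $\delta\in(a,b)$. Here "distributional chaos of type 3 with respect to $g$" means the existence of a DC3 pair with respect to $g$. "With respect to $f^2$" means that the definitions of the distribution functions, of a DC3 pair and of distributional chaos of type 3 are applied with $g=f^2$, so that the distances involved are $d(f^{2k}(x_1),f^{2k}(x_2))$. *)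

theory Defs
  imports "HOL-Analysis.Analysis"
begin

text \<open>
  A metric space is a carrier \<open>X\<close> with a metric \<open>d\<close>, as in the locale \<^locale>\<open>Metric_space\<close>; the
  distribution functions take values in \<^typ>\<open>ereal\<close> because \<^const>\<open>liminf\<close> and \<^const>\<open>limsup\<close>
  require a complete lattice. The averaged sequence lies in \<open>[0, 2]\<close>, so these are
  the usual real limits. The count runs over the \<open>m + 1\<close> indices \<open>0, \<dots>, m\<close> but is
  normalised by \<open>m\<close>; the junk value at \<open>m = 0\<close> does not affect the limits.
\<close>

definition visit_freq ::
  "('a \<Rightarrow> 'a \<Rightarrow> real) \<Rightarrow> ('a \<Rightarrow> 'a) \<Rightarrow> 'a \<Rightarrow> 'a \<Rightarrow> real \<Rightarrow> nat \<Rightarrow> real" where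
  "visit_freq d g x1 x2 \<delta> m =
     1 / real m * real (card {k. 0 \<le> k \<and> k \<le> m \<and> d ((g ^^ k) x1) ((g ^^ k) x2) < \<delta>})"

definition lower_dist ::
  "('a \<Rightarrow> 'a \<Rightarrow> real) \<Rightarrow> ('a \<Rightarrow> 'a) \<Rightarrow> 'a \<Rightarrow> 'a \<Rightarrow> real \<Rightarrow> ereal" where
  "lower_dist d g x1 x2 \<delta> = liminf (\<lambda>m. ereal (visit_freq d g x1 x2 \<delta> m))"

definition upper_dist ::
  "('a \<Rightarrow> 'a \<Rightarrow> real) \<Rightarrow> ('a \<Rightarrow> 'a) \<Rightarrow> 'a \<Rightarrow> 'a \<Rightarrow> real \<Rightarrow> ereal" where
  "upper_dist d g x1 x2 \<delta> = limsup (\<lambda>m. ereal (visit_freq d g x1 x2 \<delta> m))"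

text \<open>Meaningful for non-empty bounded \<open>X\<close> only, in particular for non-empty compact \<open>X\<close>.\<close>

definition space_diam :: "'a set \<Rightarrow> ('a \<Rightarrow> 'a \<Rightarrow> real) \<Rightarrow> real" where
  "space_diam X d = (SUP (x, y) \<in> X \<times> X. d x y)"

definition DC3_pair ::
  "'a set \<Rightarrow> ('a \<Rightarrow> 'a \<Rightarrow> real) \<Rightarrow> ('a \<Rightarrow> 'a) \<Rightarrow> 'a \<Rightarrow> 'a \<Rightarrow> bool" where
  "DC3_pair X d g x1 x2 \<longleftrightarrow> x1 \<in> X \<and> x2 \<in> X \<and>
     (\<exists>a b. 0 \<le> a \<and> a < b \<and> b \<le> space_diam X d \<and>
        (\<forall>\<delta> \<in> {a<..<b}. lower_dist d g x1 x2 \<delta> < upper_dist d g x1 x2 \<delta>))"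

definition DC3 :: "'a set \<Rightarrow> ('a \<Rightarrow> 'a \<Rightarrow> real) \<Rightarrow> ('a \<Rightarrow> 'a) \<Rightarrow> bool" where
  "DC3 X d g \<longleftrightarrow> (\<exists>x1 x2. DC3_pair X d g x1 x2)"

end

theory Submission
  imports Defs "HOL-Library.Discrete_Functions" "HOL-Real_Asymp.Real_Asymp"
begin

text \<open>
  A point carries a parity, a side, a position \<open>t\<close> in the unit interval and a height \<open>h\<close>. The map
  flips the parity at each step. Points of height \<open>0\<close> have period two; two orbits, one on each
  side, descend to height \<open>0\<close> while their positions follow waves with ever slower motion that
  rest at \<open>0\<close> half of the time and at \<open>1\<close> half of the time. Across the sides, positions at
  distance \<open>e\<close> give points at distance \<open>1 + e\<close> for one parity and \<open>2 - e\<close> for the other. Under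
  \<open>f\<close> the parity alternates, and since \<open>e\<close> is nearly always \<open>a\<close> or \<open>1 - a\<close> for a constant \<open>a\<close>,
  consecutive distances form the multiset \<open>{1 + a, 2 - a}\<close>: frequencies converge. On the same side they
  converge because each wave has an asymptotic distribution. Under \<open>f \<circ> f\<close> only the distance \<open>1 + e\<close>
  is seen, and the two waves are in phase and out of phase on alternating dyadic ranges, so the
  frequency of \<open>e < \<epsilon>\<close> has no limit.
\<close>

subsection \<open>Asymptotic means\<close>

text \<open>A Cesaro mean; for the indicator of a set of indices it is the asymptotic density of
  that set.\<close>

definition has_mean :: "(nat \<Rightarrow> real) \<Rightarrow> real \<Rightarrow> bool" where
  "has_mean c l \<longleftrightarrow> (\<lambda>n. (\<Sum>k<n. c k) / real n) \<longlonglongrightarrow> l"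

lemma has_mean_cong: "has_mean c l \<Longrightarrow> (\<And>k. c k = c' k) \<Longrightarrow> has_mean c' l"
  by (simp add: has_mean_def)

lemma has_mean_add: "has_mean c l \<Longrightarrow> has_mean c' l' \<Longrightarrow> has_mean (\<lambda>k. c k + c' k) (l + l')"
  unfolding has_mean_def by (simp add: sum.distrib add_divide_distrib tendsto_add)

lemma has_mean_cmult: "has_mean c l \<Longrightarrow> has_mean (\<lambda>k. a * c k) (a * l)"
  unfolding has_mean_def
  by (simp add: sum_distrib_left [symmetric] times_divide_eq_right [symmetric] tendsto_mult_left
      del: times_divide_eq_right)

lemma has_mean_diff: "has_mean c l \<Longrightarrow> has_mean c' l' \<Longrightarrow> has_mean (\<lambda>k. c k - c' k) (l - l')"
  using has_mean_add [OF _ has_mean_cmult [of c' l' "-1"]] by simp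

lemma has_mean_const: "has_mean (\<lambda>k. a) a"
proof -
  have "\<forall>\<^sub>F n in sequentially. a = (\<Sum>k<n. a) / real n"
    using eventually_gt_at_top [of 0] by eventually_elim simp
  then show ?thesis
    unfolding has_mean_def by (rule Lim_transform_eventually [OF tendsto_const])
qed

text \<open>The two averages differ by the factor \<open>(n + 1) / n\<close>, which tends to 1, and
  by the single term \<open>c 0\<close>, which vanishes after division by \<open>n\<close>.\<close>

lemma has_mean_Suc_iff: "has_mean (\<lambda>k. c (Suc k)) l \<longleftrightarrow> has_mean c l"
proof -
  define S where "S n = (\<Sum>k<n. c k)" for n
  have S: "(\<Sum>k<n. c (Suc k)) = S (Suc n) - c 0" for n
    unfolding S_def by (subst sum.lessThan_Suc_shift) simp
  have q: "(\<lambda>n. real (Suc n) / real n) \<longlonglongrightarrow> 1" "(\<lambda>n. real n / real (Suc n)) \<longlonglongrightarrow> 1"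
    "(\<lambda>n. c 0 / real n) \<longlonglongrightarrow> 0" "(\<lambda>n. c 0 / real (Suc n)) \<longlonglongrightarrow> 0"
    by real_asymp+
  have "(\<lambda>n. (S (Suc n) - c 0) / real n) \<longlonglongrightarrow> l" if "(\<lambda>n. S (Suc n) / real (Suc n)) \<longlonglongrightarrow> l"
  proof (rule Lim_transform_eventually)
    show "(\<lambda>n. S (Suc n) / real (Suc n) * (real (Suc n) / real n) - c 0 / real n) \<longlonglongrightarrow> l"
      using tendsto_diff [OF tendsto_mult [OF that q(1)] q(3)] by simp
    show "\<forall>\<^sub>F n in sequentially. S (Suc n) / real (Suc n) * (real (Suc n) / real n) - c 0 / real n
            = (S (Suc n) - c 0) / real n"
      using eventually_gt_at_top [of 0] by eventually_elim (simp add: diff_divide_distrib)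
  qed
  moreover have "(\<lambda>n. S (Suc n) / real (Suc n)) \<longlonglongrightarrow> l" if "(\<lambda>n. (S (Suc n) - c 0) / real n) \<longlonglongrightarrow> l"
  proof (rule Lim_transform_eventually)
    show "(\<lambda>n. (S (Suc n) - c 0) / real n * (real n / real (Suc n)) + c 0 / real (Suc n)) \<longlonglongrightarrow> l"
      using tendsto_add [OF tendsto_mult [OF that q(2)] q(4)] by simp
    show "\<forall>\<^sub>F n in sequentially. (S (Suc n) - c 0) / real n * (real n / real (Suc n)) + c 0 / real (Suc n)
            = S (Suc n) / real (Suc n)"
      using eventually_gt_at_top [of 0] by eventually_elim (simp add: add_divide_distrib [symmetric])
  qed
  ultimately show ?thesis
    unfolding has_mean_def S using filterlim_sequentially_Suc [of "\<lambda>n. S n / real n" "nhds l"] by (auto simp: S_def)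
qed

lemma has_mean_shift_iff: "has_mean (\<lambda>k. c (m + k)) l \<longleftrightarrow> has_mean c l"
proof (induction m)
  case (Suc m)
  then show ?case
    using has_mean_Suc_iff [of "\<lambda>k. c (m + k)" l] by simp
qed simp

lemma has_mean_0_dominated:
  assumes "has_mean g 0" "\<And>k. \<bar>c k\<bar> \<le> g k"
  shows "has_mean c 0"
  unfolding has_mean_def
proof (rule Lim_null_comparison)
  show "(\<lambda>n. (\<Sum>k<n. g k) / real n) \<longlonglongrightarrow> 0"
    using assms(1) by (simp add: has_mean_def)
  show "\<forall>\<^sub>F n in sequentially. norm ((\<Sum>k<n. c k) / real n) \<le> (\<Sum>k<n. g k) / real n"
    by (auto intro!: always_eventually divide_right_mono order.trans [OF sum_abs] sum_mono assms(2))
qed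

text \<open>The typical \<open>g\<close> is the indicator of a set of density 0 outside which
  \<open>c\<close> and \<open>c'\<close> agree.\<close>

lemma has_mean_dominated:
  assumes "has_mean g 0" "has_mean c' l" "\<And>k. \<bar>c k - c' k\<bar> \<le> g k"
  shows "has_mean c l"
  using has_mean_add [OF has_mean_0_dominated [OF assms(1,3)] assms(2)] by simp

lemma has_mean_eventually:
  assumes "has_mean c l" "\<forall>\<^sub>F k in sequentially. c k = c' k"
  shows "has_mean c' l"
proof -
  obtain N where N: "\<And>k. k \<ge> N \<Longrightarrow> c k = c' k"
    using assms(2) by (auto simp: eventually_sequentially)
  have "has_mean (\<lambda>k. c (N + k)) l"
    using assms(1) has_mean_shift_iff by blast
  then have "has_mean (\<lambda>k. c' (N + k)) l"
    by (rule has_mean_cong) (simp add: N)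
  then show ?thesis
    using has_mean_shift_iff by blast
qed

text \<open>A partial sum up to an even index is a partial sum of the pair sums with half as many
  terms; at an odd index one bounded term is left over. The even-indexed and odd-indexed
  subsequences may fail to have means, which is what the construction exploits.\<close>

lemma has_mean_pairs:
  assumes "has_mean (\<lambda>k. c (2 * k) + c (2 * k + 1)) l" "\<And>k. \<bar>c k\<bar> \<le> 1"
  shows "has_mean c (l / 2)"
proof -
  define B where "B n = (\<Sum>k<n. c (2 * k) + c (2 * k + 1))" for n
  have B: "(\<Sum>k<2 * n. c k) = B n" for n
    by (induction n) (simp_all add: B_def)
  have s: "(\<Sum>k<n. c k) = B (n div 2) + (if odd n then c (n - 1) else 0)" for n
  proof (cases "even n")
    case True
    then show ?thesis using B [of "n div 2"] by simp
  next
    case False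
    then obtain m where "n = Suc (2 * m)" by (metis oddE Suc_eq_plus1)
    then show ?thesis using B [of m] by simp
  qed
  have half: "filterlim (\<lambda>n::nat. n div 2) at_top sequentially"
    by real_asymp
  have "(\<lambda>n. B n / real n) \<longlonglongrightarrow> l"
    using assms(1) by (simp add: has_mean_def B_def)
  then have "(\<lambda>n. B (n div 2) / real (n div 2)) \<longlonglongrightarrow> l"
    by (rule filterlim_compose [OF _ half])
  moreover have "(\<lambda>n. real (n div 2) / real n) \<longlonglongrightarrow> 1 / 2"
    by real_asymp
  ultimately have m: "(\<lambda>n. B (n div 2) / real (n div 2) * (real (n div 2) / real n)) \<longlonglongrightarrow> l * (1 / 2)"
    by (rule tendsto_mult)
  have r: "(\<lambda>n. (if odd n then c (n - 1) else 0) / real n) \<longlonglongrightarrow> 0"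
  proof (rule Lim_null_comparison)
    show "(\<lambda>n. 1 / real n) \<longlonglongrightarrow> 0" by real_asymp
    show "\<forall>\<^sub>F n in sequentially. norm ((if odd n then c (n - 1) else 0) / real n) \<le> 1 / real n"
      by (auto intro!: always_eventually divide_right_mono assms(2))
  qed
  show ?thesis
    unfolding has_mean_def
  proof (rule Lim_transform_eventually)
    show "(\<lambda>n. B (n div 2) / real (n div 2) * (real (n div 2) / real n)
             + (if odd n then c (n - 1) else 0) / real n) \<longlonglongrightarrow> l / 2"
      using tendsto_add [OF m r] by simp
    show "\<forall>\<^sub>F n in sequentially. B (n div 2) / real (n div 2) * (real (n div 2) / real n)
             + (if odd n then c (n - 1) else 0) / real n = (\<Sum>k<n. c k) / real n"
      \<comment> \<open>For \<open>n > 1\<close> the factor \<open>n div 2\<close> is nonzero and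
        cancels.\<close>
      using eventually_gt_at_top [of 1]
      by eventually_elim (auto simp: s add_divide_distrib)
  qed
qed

section \<open>Averages over the blocks between consecutive squares\<close>

lemma sum_lessThan_add:
  fixes g :: "nat \<Rightarrow> real"
  shows "(\<Sum>n<m + p. g n) = (\<Sum>n<m. g n) + (\<Sum>j<p. g (m + j))"
  by (induction p) simp_all

lemma sum_square_blocks:
  fixes g :: "nat \<Rightarrow> real"
  shows "(\<Sum>n<K\<^sup>2. g n) = (\<Sum>k<K. \<Sum>j<2 * k + 1. g (k\<^sup>2 + j))"
proof (induction K)
  case (Suc K)
  have "(Suc K)\<^sup>2 = K\<^sup>2 + (2 * K + 1)"
    by (simp add: power2_eq_square)
  then have "(\<Sum>n<(Suc K)\<^sup>2. g n) = (\<Sum>n<K\<^sup>2. g n) + (\<Sum>j<2 * K + 1. g (K\<^sup>2 + j))"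
    by (simp only: sum_lessThan_add)
  then show ?case
    using Suc by simp
qed simp

text \<open>At most \<open>sqrt n\<close> complete blocks lie below \<open>n\<close>, and together
  they contribute at most the order of \<open>n\<close> to the power 3/4; the incomplete last block
  has at most \<open>2 * sqrt n + 1\<close> terms. Both are negligible against \<open>n\<close>, so
  an error of order \<open>sqrt K\<close> per block is admissible.\<close>

lemma has_mean_square_blocks:
  assumes "\<And>n. \<bar>g n\<bar> \<le> 1" "C \<ge> 0"
    and blk: "\<And>K. \<bar>\<Sum>j<2 * K + 1. g (K\<^sup>2 + j)\<bar> \<le> C * (1 + sqrt (real K))"
  shows "has_mean g 0"
  unfolding has_mean_def
proof (rule Lim_null_comparison)
  show "(\<lambda>n. (sqrt n * (C * (1 + sqrt (sqrt n))) + (2 * sqrt n + 1)) / real n) \<longlonglongrightarrow> 0"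
    by real_asymp
  have "\<bar>\<Sum>k<n. g k\<bar> \<le> sqrt n * (C * (1 + sqrt (sqrt n))) + (2 * sqrt n + 1)" for n
  proof -
    define K where "K = floor_sqrt n"
    have K: "K\<^sup>2 \<le> n" "n < K\<^sup>2 + 2 * K + 1"
      using Suc_floor_sqrt_power2_gt [of n] floor_sqrt_power2_le [of n]
      by (simp_all add: K_def power2_eq_square)
    have Kr: "real K \<le> sqrt n"
      using K(1) by (metis of_nat_le_iff of_nat_power real_le_rsqrt)
    have "(\<Sum>k<n. g k) = (\<Sum>k<K\<^sup>2. g k) + (\<Sum>k\<in>{K\<^sup>2..<n}. g k)"
      using K(1) by (simp add: lessThan_atLeast0 sum.atLeastLessThan_concat)
    also have "\<bar>\<dots>\<bar> \<le> \<bar>\<Sum>k<K\<^sup>2. g k\<bar> + \<bar>\<Sum>k\<in>{K\<^sup>2..<n}. g k\<bar>"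
      by (rule abs_triangle_ineq)
    also have "\<bar>\<Sum>k<K\<^sup>2. g k\<bar> \<le> sqrt n * (C * (1 + sqrt (sqrt n)))"
    proof -
      have "\<bar>\<Sum>k<K\<^sup>2. g k\<bar> \<le> (\<Sum>k<K. \<bar>\<Sum>j<2 * k + 1. g (k\<^sup>2 + j)\<bar>)"
        unfolding sum_square_blocks by (rule sum_abs)
      also have "\<dots> \<le> (\<Sum>k<K. C * (1 + sqrt (sqrt n)))"
      proof (rule sum_mono)
        fix k assume "k \<in> {..<K}"
        then have "real k \<le> sqrt n" using Kr by simp
        then have "C * (1 + sqrt (real k)) \<le> C * (1 + sqrt (sqrt n))"
          using assms(2) by (intro mult_left_mono) auto
        then show "\<bar>\<Sum>j<2 * k + 1. g (k\<^sup>2 + j)\<bar> \<le> C * (1 + sqrt (sqrt n))"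
          using blk [of k] by linarith
      qed
      also have "\<dots> \<le> sqrt n * (C * (1 + sqrt (sqrt n)))"
        using Kr assms(2) by (auto intro!: mult_right_mono)
      finally show ?thesis .
    qed
    also have "\<bar>\<Sum>k\<in>{K\<^sup>2..<n}. g k\<bar> \<le> 2 * sqrt n + 1"
    proof -
      have "\<bar>\<Sum>k\<in>{K\<^sup>2..<n}. g k\<bar> \<le> (\<Sum>k\<in>{K\<^sup>2..<n}. 1)"
        by (rule order.trans [OF sum_abs sum_mono]) (rule assms(1))
      also have "\<dots> \<le> real (2 * K + 1)"
        using K by (simp del: of_nat_diff)
      finally show ?thesis using Kr by simp
    qed
    finally show ?thesis by simp
  qed
  then show "\<forall>\<^sub>F n in sequentially. norm ((\<Sum>k<n. g k) / real n)
        \<le> (sqrt n * (C * (1 + sqrt (sqrt n))) + (2 * sqrt n + 1)) / real n"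
    by (auto intro!: always_eventually divide_right_mono)
qed

section \<open>Distribution functions as limits of means of indicators\<close>

lemma visit_freq_eq:
  "visit_freq d g x y \<delta> m
     = (\<Sum>k<Suc m. of_bool (d ((g ^^ k) x) ((g ^^ k) y) < \<delta>)) / real m"
proof -
  have "{k. 0 \<le> k \<and> k \<le> m \<and> d ((g ^^ k) x) ((g ^^ k) y) < \<delta>}
      = {..<Suc m} \<inter> {k. d ((g ^^ k) x) ((g ^^ k) y) < \<delta>}"
    by auto
  then show ?thesis
    by (simp add: visit_freq_def sum_of_bool_eq del: sum.lessThan_Suc)
qed

text \<open>The count runs over \<open>m + 1\<close> indices but is divided by \<open>m\<close>.
  Splitting off index 0, at the cost of \<open>c 0 / m\<close>, leaves an average of
  \<open>m\<close> terms of the shifted sequence.\<close>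

lemma visit_freq_tendsto_iff:
  "(visit_freq d g x y \<delta>) \<longlonglongrightarrow> l
     \<longleftrightarrow> has_mean (\<lambda>k. of_bool (d ((g ^^ k) x) ((g ^^ k) y) < \<delta>)) l"
proof -
  define c :: "nat \<Rightarrow> real" where "c k = of_bool (d ((g ^^ k) x) ((g ^^ k) y) < \<delta>)" for k
  have "(\<lambda>n. (\<Sum>k<n. c (Suc k)) / real n) \<longlonglongrightarrow> l \<longleftrightarrow>
     (\<lambda>n. (\<Sum>k<Suc n. c k) / real n) \<longlonglongrightarrow> l"
  proof -
    have q: "(\<lambda>n. c 0 / real n) \<longlonglongrightarrow> 0" by real_asymp
    have "(\<Sum>k<Suc n. c k) / real n = (\<Sum>k<n. c (Suc k)) / real n + c 0 / real n" for n
      by (subst sum.lessThan_Suc_shift) (simp add: add_divide_distrib)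
    then show ?thesis
      using tendsto_add [OF _ q, of "\<lambda>n. (\<Sum>k<n. c (Suc k)) / real n" l]
        tendsto_diff [OF _ q, of "\<lambda>n. (\<Sum>k<Suc n. c k) / real n" l] by auto
  qed
  then show ?thesis
    using has_mean_Suc_iff [of c l] by (simp add: visit_freq_eq [abs_def] has_mean_def c_def)
qed

lemma lower_eq_upper_dist:
  assumes "has_mean (\<lambda>k. of_bool (d ((g ^^ k) x) ((g ^^ k) y) < \<delta>)) l"
  shows "lower_dist d g x y \<delta> = upper_dist d g x y \<delta>"
proof -
  have "convergent (\<lambda>m. ereal (visit_freq d g x y \<delta> m))"
    using assms unfolding visit_freq_tendsto_iff [symmetric]
    by (auto simp: convergent_def intro: tendsto_ereal)
  then show ?thesis
    by (simp add: convergent_ereal lower_dist_def upper_dist_def)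
qed

text \<open>Equality of the two limits would give convergence in \<open>ereal\<close>; the
  frequencies are bounded, so the limit would be a real number and hence a mean.\<close>

lemma lower_less_upper_dist:
  assumes "\<And>l. \<not> has_mean (\<lambda>k. of_bool (d ((g ^^ k) x) ((g ^^ k) y) < \<delta>)) l"
  shows "lower_dist d g x y \<delta> < upper_dist d g x y \<delta>"
proof (rule ccontr)
  assume "\<not> ?thesis"
  then have "limsup (\<lambda>m. ereal (visit_freq d g x y \<delta> m)) = liminf (\<lambda>m. ereal (visit_freq d g x y \<delta> m))"
    using Liminf_le_Limsup [of sequentially "\<lambda>m. ereal (visit_freq d g x y \<delta> m)"]
    by (simp add: lower_dist_def upper_dist_def)
  then obtain L where L: "(\<lambda>m. ereal (visit_freq d g x y \<delta> m)) \<longlonglongrightarrow> L"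
    by (auto simp: convergent_ereal [symmetric] convergent_def)
  \<comment> \<open>For positive \<open>m\<close> use \<open>m + 1 \<le> 2 * m\<close>; at
    \<open>m = 0\<close> division by zero gives the value 0.\<close>
  have "\<bar>visit_freq d g x y \<delta> m\<bar> \<le> 2" for m
  proof (cases "m = 0")
    case False
    have "\<bar>\<Sum>k<Suc m. of_bool (d ((g ^^ k) x) ((g ^^ k) y) < \<delta>) :: real\<bar> \<le> (\<Sum>k<Suc m. 1)"
      by (rule order.trans [OF sum_abs sum_mono]) simp
    also have "\<dots> \<le> 2 * real m"
      using False by simp
    finally show ?thesis
      using False by (simp add: visit_freq_eq field_simps del: sum.lessThan_Suc)
  qed (simp add: visit_freq_eq)
  then have b: "ereal (-2) \<le> ereal (visit_freq d g x y \<delta> m)" "ereal (visit_freq d g x y \<delta> m) \<le> ereal 2" for m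
    by (auto simp: abs_le_iff) (smt (verit))
  have "ereal (-2) \<le> L" "L \<le> ereal 2"
    using tendsto_lowerbound [OF L, of "ereal (-2)"] tendsto_upperbound [OF L, of "ereal 2"] b by auto
  then obtain l where "L = ereal l"
    by (cases L) auto
  with L assms show False
    by (auto simp: visit_freq_tendsto_iff [symmetric])
qed

subsection \<open>The two waves\<close>

text \<open>
  On the block \<open>K\<^sup>2 \<le> n \<le> K\<^sup>2 + 2 K\<close> a wave goes from \<open>1\<close> down to \<open>0\<close> and back. The ramp length
  \<open>1 + sqrt K\<close> is unbounded, so the steps tend to \<open>0\<close>, but negligible against \<open>K\<close>, so the ramps
  have density \<open>0\<close>. The second wave is shifted by \<open>K / 4\<close> when \<open>floor_log K\<close> is odd; the shift keeps
  both ends of the block at \<open>1\<close>, so it can be switched on and off between blocks.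
\<close>

definition trapezoid :: "real \<Rightarrow> nat \<Rightarrow> nat \<Rightarrow> real" where
  "trapezoid s K j = max 0 (min 1 ((\<bar>real j - (1 - s) * real K\<bar> - real K / 2) / (1 + sqrt (real K))))"

definition wave_shift :: "bool \<Rightarrow> nat \<Rightarrow> real" where
  "wave_shift b K = (if b \<and> odd (floor_log K) then 1 / 4 else 0)"

definition wave :: "bool \<Rightarrow> nat \<Rightarrow> real" where
  "wave b n = (let K = floor_sqrt n in trapezoid (wave_shift b K) K (n - K\<^sup>2))"

lemma trapezoid_bounds: "0 \<le> trapezoid s K j" "trapezoid s K j \<le> 1"
  by (auto simp: trapezoid_def)

lemma trapezoid_eq_0_iff: "trapezoid s K j = 0 \<longleftrightarrow> \<bar>real j - (1 - s) * real K\<bar> \<le> real K / 2"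
proof -
  have "1 + sqrt (real K) > 0" by (simp add: add_pos_nonneg)
  then show ?thesis
    by (auto simp: trapezoid_def max_def min_def divide_simps)
qed

lemma trapezoid_eq_1_iff:
  "trapezoid s K j = 1 \<longleftrightarrow> real K / 2 + 1 + sqrt (real K) \<le> \<bar>real j - (1 - s) * real K\<bar>"
proof -
  have "1 + sqrt (real K) > 0" by (simp add: add_pos_nonneg)
  then show ?thesis
    by (auto simp: trapezoid_def max_def min_def divide_simps)
qed

text \<open>Both the absolute value and the truncation to the unit interval are 1-Lipschitz, so only
  the slope of the ramp remains.\<close>

lemma trapezoid_step: "\<bar>trapezoid s K (Suc j) - trapezoid s K j\<bar> \<le> 1 / (1 + sqrt (real K))"
proof -
  define r where "r = 1 + sqrt (real K)"
  have r: "r > 0" by (simp add: r_def add_pos_nonneg)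
  define x y where "x = (\<bar>real (Suc j) - (1 - s) * real K\<bar> - real K / 2) / r"
    and "y = (\<bar>real j - (1 - s) * real K\<bar> - real K / 2) / r"
  have "\<bar>x - y\<bar> = \<bar>\<bar>real (Suc j) - (1 - s) * real K\<bar> - \<bar>real j - (1 - s) * real K\<bar>\<bar> / r"
    using r by (simp add: x_def y_def diff_divide_distrib [symmetric])
  also have "\<dots> \<le> 1 / r"
    using r by (intro divide_right_mono) auto
  finally have "\<bar>x - y\<bar> \<le> 1 / r" .
  moreover have "\<bar>max 0 (min 1 x) - max 0 (min 1 y)\<bar> \<le> \<bar>x - y\<bar>"
    by (auto simp: max_def min_def)
  ultimately show ?thesis
    unfolding trapezoid_def r_def [symmetric] x_def [symmetric] y_def [symmetric]
    by (rule order.trans [rotated])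
qed

lemma floor_sqrt_block:
  assumes "j \<le> 2 * K"
  shows "floor_sqrt (K\<^sup>2 + j) = K"
  using assms by (intro floor_sqrt_unique) (auto simp: power2_eq_square)

lemma wave_block: "j \<le> 2 * K \<Longrightarrow> wave b (K\<^sup>2 + j) = trapezoid (wave_shift b K) K j"
  by (simp add: wave_def floor_sqrt_block)

lemma wave_bounds: "0 \<le> wave b n" "wave b n \<le> 1"
  by (auto simp: wave_def Let_def trapezoid_bounds)

lemma wave_shift_bounds: "0 \<le> wave_shift b K" "wave_shift b K \<le> 1 / 4"
  by (auto simp: wave_shift_def)

text \<open>Ramps this short fit between the zero plateau and either end of its block, and for large
  \<open>K\<close> they leave at least \<open>K / 8\<close> indices at which the shifted and the
  unshifted wave differ by 1.\<close>

lemma eventually_sqrt_small: "\<forall>\<^sub>F K::nat in sequentially. 1 + sqrt (real K) \<le> real K / 16"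
  by real_asymp

lemma filterlim_floor_sqrt: "filterlim floor_sqrt at_top sequentially"
  unfolding filterlim_at_top
proof
  fix Z
  show "\<forall>\<^sub>F n in sequentially. Z \<le> floor_sqrt n"
    using eventually_ge_at_top [of "Z\<^sup>2"] by eventually_elim (simp add: le_floor_sqrtI)
qed

text \<open>Inside a block the slope of the ramp bounds the step. From the last index of a block to
  the first of the next, both values are 1 once ramps are short, even if the shift is switched
  there.\<close>

lemma wave_step: "(\<lambda>n. wave b (Suc n) - wave b n) \<longlonglongrightarrow> 0"
proof (rule Lim_null_comparison)
  have "(\<lambda>K::nat. 1 / (1 + sqrt (real K))) \<longlonglongrightarrow> 0"
    by real_asymp
  then show "(\<lambda>n. 1 / (1 + sqrt (real (floor_sqrt n)))) \<longlonglongrightarrow> 0"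
    by (rule filterlim_compose [OF _ filterlim_floor_sqrt])
  have "\<forall>\<^sub>F K in sequentially. 1 + sqrt (real K) \<le> real K / 16
          \<and> 1 + sqrt (real (Suc K)) \<le> real (Suc K) / 16"
    using eventually_sqrt_small eventually_sequentially_Suc [THEN iffD2, OF eventually_sqrt_small]
    by (rule eventually_conj)
  then have "\<forall>\<^sub>F n in sequentially. 1 + sqrt (real (floor_sqrt n)) \<le> real (floor_sqrt n) / 16
          \<and> 1 + sqrt (real (Suc (floor_sqrt n))) \<le> real (Suc (floor_sqrt n)) / 16"
    by (rule eventually_compose_filterlim [OF _ filterlim_floor_sqrt])
  then show "\<forall>\<^sub>F n in sequentially.
     norm (wave b (Suc n) - wave b n) \<le> 1 / (1 + sqrt (real (floor_sqrt n)))"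
  proof eventually_elim
    case (elim n)
    define K where "K = floor_sqrt n"
    obtain j where j: "n = K\<^sup>2 + j" "j \<le> 2 * K"
    proof
      show "n = K\<^sup>2 + (n - K\<^sup>2)"
        using floor_sqrt_power2_le [of n] by (simp add: K_def)
      show "n - K\<^sup>2 \<le> 2 * K"
        using Suc_floor_sqrt_power2_gt [of n] by (simp add: K_def power2_eq_square)
    qed
    show ?case
    proof (cases "j < 2 * K")
      case True
      then have "wave b (Suc n) = trapezoid (wave_shift b K) K (Suc j)"
        using wave_block [of "Suc j" K b] by (simp add: j)
      moreover have "wave b n = trapezoid (wave_shift b K) K j"
        using wave_block [OF j(2)] j(1) by simp
      ultimately show ?thesis
        using trapezoid_step by (simp add: K_def)
    next
      case False
      then have "j = 2 * K"
        using j by simp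
      then have "Suc n = (Suc K)\<^sup>2"
        using j by (simp add: power2_eq_square)
      then have "wave b (Suc n) = trapezoid (wave_shift b (Suc K)) (Suc K) 0"
        using wave_block [of 0 "Suc K" b] by simp
      also have "\<dots> = 1"
      proof -
        \<comment> \<open>The first index is at distance at least 3/4 of the block parameter from
          the centre of the plateau; half of the parameter plus a ramp is enough for the value
          1.\<close>
        have "(1 - wave_shift b (Suc K)) * real (Suc K) \<ge> (3 / 4) * real (Suc K)"
          using wave_shift_bounds [of b "Suc K"] by (intro mult_right_mono) auto
        then have "real (Suc K) / 2 + 1 + sqrt (real (Suc K)) \<le> (1 - wave_shift b (Suc K)) * real (Suc K)"
          using elim unfolding K_def [symmetric] by linarith
        then show ?thesis
          by (simp add: trapezoid_eq_1_iff)
      qed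
      finally have 1: "wave b (Suc n) = 1" .
      have "wave b n = trapezoid (wave_shift b K) K (2 * K)"
        using wave_block [OF j(2)] j(1) \<open>j = 2 * K\<close> by simp
      also have "\<dots> = 1"
      proof -
        \<comment> \<open>A shift moves the centre only to the left, so the last index stays at
          distance at least \<open>K\<close> from it.\<close>
        have "(1 - wave_shift b K) * real K \<le> 1 * real K"
          using wave_shift_bounds [of b K] by (intro mult_right_mono) auto
        then show ?thesis
          using elim by (simp add: trapezoid_eq_1_iff K_def)
      qed
      finally show ?thesis
        using 1 by simp
    qed
  qed
qed

section \<open>Densities of the values of a wave\<close>

lemma card_nat_interval:
  fixes \<alpha> \<beta> :: real
  assumes "0 \<le> \<alpha>" "\<alpha> \<le> \<beta>"
  shows "\<bar>real (card {j::nat. \<alpha> \<le> real j \<and> real j \<le> \<beta>}) - (\<beta> - \<alpha>)\<bar> \<le> 1"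
proof -
  define A B where "A = nat \<lceil>\<alpha>\<rceil>" and "B = nat \<lfloor>\<beta>\<rfloor>"
  have "{j::nat. \<alpha> \<le> real j \<and> real j \<le> \<beta>} = {A..B}"
    using assms by (auto simp: A_def B_def le_nat_iff nat_le_iff le_floor_iff ceiling_le_iff)
  then have "card {j::nat. \<alpha> \<le> real j \<and> real j \<le> \<beta>} = Suc B - A"
    by simp
  moreover have "\<alpha> \<le> real A" "real A < \<alpha> + 1" "real B \<le> \<beta>" "\<beta> - 1 < real B"
    using assms by (auto simp: A_def B_def) linarith+
  ultimately show ?thesis
    using assms by (cases "A \<le> Suc B") (auto simp: of_nat_diff)
qed

text \<open>The left end may be negative, as for ramps of small blocks; cutting the interval at 0
  only shortens it.\<close>

lemma card_nat_interval_le: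
  fixes \<alpha> \<beta> :: real
  assumes "\<alpha> \<le> \<beta>"
  shows "real (card {j::nat. \<alpha> \<le> real j \<and> real j \<le> \<beta>}) \<le> \<beta> - \<alpha> + 1"
proof (cases "\<beta> < 0")
  case True
  then have "{j::nat. \<alpha> \<le> real j \<and> real j \<le> \<beta>} = {}"
    by auto
  then show ?thesis using assms by (simp only: card.empty)
next
  case False
  have "{j::nat. \<alpha> \<le> real j \<and> real j \<le> \<beta>} = {j. max 0 \<alpha> \<le> real j \<and> real j \<le> \<beta>}"
    by auto
  moreover have "real (card {j::nat. max 0 \<alpha> \<le> real j \<and> real j \<le> \<beta>}) - (\<beta> - max 0 \<alpha>) \<le> 1"
    by (rule abs_le_D1 [OF card_nat_interval]) (use False assms in auto)
  moreover have "\<alpha> \<le> max 0 \<alpha>"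
    by simp
  ultimately show ?thesis
    by (simp only:)
qed

lemma finite_nat_interval: "finite {j::nat. \<alpha> \<le> real j \<and> real j \<le> \<beta>}"
  by (rule finite_subset [of _ "{..nat \<lfloor>\<beta>\<rfloor>}"]) (auto simp: le_nat_iff le_floor_iff le_nat_floor)

text \<open>The zeros in a block fill an interval of length \<open>K\<close> among
  \<open>2 * K + 1\<close> indices, and the shift merely moves this interval inside the block. The
  deviation from one half is therefore bounded per block.\<close>

lemma wave_zero_mean: "has_mean (\<lambda>n. of_bool (wave b n = 0)) (1 / 2)"
proof -
  have "has_mean (\<lambda>n. of_bool (wave b n = 0) - 1 / 2) 0"
  proof (rule has_mean_square_blocks [where C = 2])
    fix K
    define s where "s = wave_shift b K"
    define k where "k = real K"
    define a where "a = s * k"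
    \<comment> \<open>This keeps the shifted zero interval from being cut off by the ends of the
      block.\<close>
    have a: "0 \<le> a" "a \<le> k / 4"
      using wave_shift_bounds [of b K] mult_right_mono [of s "1 / 4" k] by (simp_all add: a_def s_def k_def)
    have "(\<Sum>j<2 * K + 1. of_bool (wave b (K\<^sup>2 + j) = 0) - 1 / 2 :: real)
        = (\<Sum>j<2 * K + 1. of_bool (\<bar>real j - (1 - s) * k\<bar> \<le> k / 2) - 1 / 2)"
      by (intro sum.cong refl) (simp add: wave_block trapezoid_eq_0_iff s_def k_def)
    also have "\<dots> = real (card ({..<2 * K + 1} \<inter> {j. \<bar>real j - (1 - s) * k\<bar> \<le> k / 2})) - (2 * k + 1) / 2"
      by (simp add: sum_subtractf sum_of_bool_eq k_def add_divide_distrib del: sum.lessThan_Suc)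
    also have "{..<2 * K + 1} \<inter> {j. \<bar>real j - (1 - s) * k\<bar> \<le> k / 2}
        = {j. k / 2 - a \<le> real j \<and> real j \<le> 3 * k / 2 - a}"
    proof (intro set_eqI)
      fix j
      have c: "(1 - s) * k = k - a"
        by (simp add: a_def algebra_simps)
      have "j < 2 * K + 1 \<longleftrightarrow> real j \<le> 2 * k"
        using of_nat_le_iff [of j "2 * K", where 'a = real]
        by (simp add: k_def less_Suc_eq_le del: of_nat_le_iff)
      then show "j \<in> {..<2 * K + 1} \<inter> {j. \<bar>real j - (1 - s) * k\<bar> \<le> k / 2}
          \<longleftrightarrow> j \<in> {j. k / 2 - a \<le> real j \<and> real j \<le> 3 * k / 2 - a}"
        using a unfolding c Int_iff mem_Collect_eq lessThan_iff by (smt (verit) field_sum_of_halves)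
    qed
    finally have *: "(\<Sum>j<2 * K + 1. of_bool (wave b (K\<^sup>2 + j) = 0) - 1 / 2 :: real)
        = real (card {j. k / 2 - a \<le> real j \<and> real j \<le> 3 * k / 2 - a}) - (2 * k + 1) / 2" .
    define c where "c = real (card {j. k / 2 - a \<le> real j \<and> real j \<le> 3 * k / 2 - a})"
    have "\<bar>c - k\<bar> \<le> 1"
      using card_nat_interval [of "k / 2 - a" "3 * k / 2 - a"] a k_def by (simp add: c_def)
    then have "\<bar>c - (2 * k + 1) / 2\<bar> \<le> 2"
      by (simp add: add_divide_distrib)
    also have "\<dots> \<le> 2 * (1 + sqrt (real K))"
      by simp
    finally show "\<bar>\<Sum>j<2 * K + 1. of_bool (wave b (K\<^sup>2 + j) = 0) - 1 / 2 :: real\<bar> \<le> 2 * (1 + sqrt (real K))"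
      unfolding * c_def .
  qed (auto simp: of_bool_def)
  from has_mean_add [OF this has_mean_const [of "1/2"]] show ?thesis
    by simp
qed

text \<open>Intermediate values occur only on the two ramps of a block, covered by \<open>P\<close>
  and \<open>Q\<close>. Each has length \<open>1 + sqrt K\<close>, within the error allowed per
  block.\<close>

lemma wave_transition_mean: "has_mean (\<lambda>n. of_bool (wave b n \<noteq> 0 \<and> wave b n \<noteq> 1)) 0"
proof (rule has_mean_square_blocks [where C = 4])
  fix K
  define s where "s = wave_shift b K"
  define k where "k = real K"
  define a where "a = (1 - s) * k"
  define r where "r = 1 + sqrt k"
  define P where "P = {j::nat. a + k / 2 \<le> real j \<and> real j \<le> a + k / 2 + r}"
  define Q where "Q = {j::nat. a - k / 2 - r \<le> real j \<and> real j \<le> a - k / 2}"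
  have r: "r \<ge> 1" by (simp add: r_def k_def)
  have "(\<Sum>j<2 * K + 1. of_bool (wave b (K\<^sup>2 + j) \<noteq> 0 \<and> wave b (K\<^sup>2 + j) \<noteq> 1) :: real)
      = (\<Sum>j<2 * K + 1. of_bool (trapezoid s K j \<noteq> 0 \<and> trapezoid s K j \<noteq> 1))"
    by (intro sum.cong refl) (simp add: wave_block s_def)
  also have "\<dots> = real (card ({..<2 * K + 1} \<inter> {j. trapezoid s K j \<noteq> 0 \<and> trapezoid s K j \<noteq> 1}))"
    by (simp add: sum_of_bool_eq del: sum.lessThan_Suc)
  also have "\<dots> \<le> real (card P + card Q)"
  proof -
    have "j \<in> P \<union> Q" if "trapezoid s K j \<noteq> 0" "trapezoid s K j \<noteq> 1" for j
      using that
      unfolding trapezoid_eq_0_iff trapezoid_eq_1_iff k_def [symmetric] a_def [symmetric]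
        P_def Q_def r_def Un_iff mem_Collect_eq by (smt (verit))
    then have "{..<2 * K + 1} \<inter> {j. trapezoid s K j \<noteq> 0 \<and> trapezoid s K j \<noteq> 1} \<subseteq> P \<union> Q"
      by auto
    then have "card ({..<2 * K + 1} \<inter> {j. trapezoid s K j \<noteq> 0 \<and> trapezoid s K j \<noteq> 1}) \<le> card (P \<union> Q)"
      by (rule card_mono [rotated]) (auto simp: P_def Q_def intro: finite_nat_interval)
    then show ?thesis
      using card_Un_le [of P Q] by linarith
  qed
  also have "\<dots> \<le> 2 * (r + 1)"
  proof -
    have "real (card P) \<le> (a + k / 2 + r) - (a + k / 2) + 1"
      unfolding P_def using r by (intro card_nat_interval_le) simp
    moreover have "real (card Q) \<le> (a - k / 2) - (a - k / 2 - r) + 1"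
      unfolding Q_def using r by (intro card_nat_interval_le) simp
    ultimately show ?thesis
      by simp
  qed
  also have "\<dots> \<le> 4 * (1 + sqrt (real K))"
    by (simp add: r_def k_def)
  finally show "\<bar>\<Sum>j<2 * K + 1. of_bool (wave b (K\<^sup>2 + j) \<noteq> 0 \<and> wave b (K\<^sup>2 + j) \<noteq> 1) :: real\<bar>
      \<le> 4 * (1 + sqrt (real K))"
    by (subst abs_of_nonneg) (auto intro: sum_nonneg simp del: sum.lessThan_Suc)
qed auto

lemma wave_one_mean: "has_mean (\<lambda>n. of_bool (wave b n = 1)) (1 / 2)"
proof (rule has_mean_cong)
  show "has_mean (\<lambda>n. 1 - of_bool (wave b n = 0) - of_bool (wave b n \<noteq> 0 \<and> wave b n \<noteq> 1)) (1 / 2)"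
    using has_mean_diff [OF has_mean_diff [OF has_mean_const [of 1] wave_zero_mean [of b]]
        wave_transition_mean [of b]] by simp
qed (auto simp: of_bool_def)

text \<open>The average of the complementary indicator \<open>g\<close> over the first
  \<open>4 ^ i\<close> indices is followed along \<open>i\<close>. A dyadic range of even logarithm
  adds nothing and so divides the average by 4, which forces the limit 0; a range of odd logarithm
  lifts it to at least 1/32.\<close>

lemma wave_coincidence_no_mean:
  assumes e: "0 < e" "e \<le> 1"
  shows "\<not> has_mean (\<lambda>n. of_bool (\<bar>wave False n - wave True n\<bar> < e)) l"
proof
  define g :: "nat \<Rightarrow> real" where "g n = 1 - of_bool (\<bar>wave False n - wave True n\<bar> < e)" for n
  define T where "T K = (\<Sum>j<2 * K + 1. g (K\<^sup>2 + j))" for K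
  assume "has_mean (\<lambda>n. of_bool (\<bar>wave False n - wave True n\<bar> < e)) l"
  then have "has_mean g (1 - l)"
    unfolding g_def by (rule has_mean_diff [OF has_mean_const])
  then obtain q where q: "has_mean g q" by blast
  have T0: "T K = 0" if "even (floor_log K)" for K
    unfolding T_def using e that
    by (intro sum.neutral) (auto simp: g_def wave_block wave_shift_def)
  have T_nonneg: "T K \<ge> 0" for K
    unfolding T_def by (intro sum_nonneg) (auto simp: g_def)
  have "\<forall>\<^sub>F K in sequentially. odd (floor_log K) \<longrightarrow> T K \<ge> real K / 8"
    using eventually_sqrt_small eventually_ge_at_top [of 100]
  proof eventually_elim
    case (elim K)
    show ?case
    proof
      assume odd: "odd (floor_log K)"
      define k where "k = real K"
      have k: "1 + sqrt k \<le> k / 16" "k \<ge> 100"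
        using elim by (auto simp: k_def)
      \<comment> \<open>On \<open>R\<close> the shifted wave has already reached 0, while the
        unshifted one has not yet begun its descent from 1.\<close>
      define R where "R = {j::nat. k / 4 \<le> real j \<and> real j \<le> k / 2 - 1 - sqrt k}"
      have "R \<subseteq> {..<2 * K + 1}"
      proof
        fix j assume "j \<in> R"
        then have "real j \<le> k / 2 - 1 - sqrt k"
          by (simp add: R_def)
        then have "real j < 2 * k"
          using k real_sqrt_ge_zero [of k] by linarith
        then show "j \<in> {..<2 * K + 1}"
          by (simp add: k_def)
      qed
      have "real K / 8 \<le> real (card R)"
        using card_nat_interval [of "k / 4" "k / 2 - 1 - sqrt k"] k unfolding R_def k_def by linarith
      also have "\<dots> = (\<Sum>j\<in>R. 1)"
        by simp
      also have "\<dots> = (\<Sum>j\<in>R. g (K\<^sup>2 + j))"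
      proof (rule sum.cong)
        fix j assume j: "j \<in> R"
        then have "j \<le> 2 * K"
          using \<open>R \<subseteq> _\<close> by auto
        moreover have "trapezoid 0 K j = 1"
        proof -
          have "k / 2 + 1 + sqrt k \<le> \<bar>real j - (1 - 0) * k\<bar>"
            using j by (auto simp: R_def)
          then show ?thesis
            by (simp add: trapezoid_eq_1_iff k_def)
        qed
        moreover have "trapezoid (1 / 4) K j = 0"
        proof -
          have "k / 4 \<le> real j" "real j \<le> k / 2"
            using j k real_sqrt_ge_zero [of k] unfolding R_def mem_Collect_eq by linarith+
          then have "\<bar>real j - (1 - 1 / 4) * k\<bar> \<le> k / 2"
            using k(2) by (intro abs_leI) auto
          then show ?thesis
            by (simp add: trapezoid_eq_0_iff k_def)
        qed
        ultimately show "1 = g (K\<^sup>2 + j)"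
          using odd e by (simp add: g_def wave_block wave_shift_def)
      qed simp
      also have "\<dots> \<le> T K"
        unfolding T_def using \<open>R \<subseteq> _\<close> by (intro sum_mono2) (auto simp: g_def)
      finally show "real K / 8 \<le> T K" .
    qed
  qed
  then obtain K0 where K0: "\<And>K. K \<ge> K0 \<Longrightarrow> odd (floor_log K) \<Longrightarrow> T K \<ge> real K / 8"
    by (auto simp: eventually_sequentially)
  \<comment> \<open>The blocks with \<open>K < 2 ^ i\<close> make up exactly the indices below
    \<open>4 ^ i\<close>.\<close>
  define U where "U i = (\<Sum>K<2 ^ i. T K)" for i :: nat
  define a where "a i = U i / 4 ^ i" for i :: nat
  have U_Suc: "U (Suc i) = U i + (\<Sum>K\<in>{2 ^ i..<2 ^ Suc i}. T K)" for i
    unfolding U_def by (simp add: lessThan_atLeast0 sum.atLeastLessThan_concat)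
  have fl: "floor_log K = i" if "K \<in> {2 ^ i..<2 ^ Suc i}" for K i
    using that by (intro floor_log_eqI) auto
  have "(\<lambda>i. (\<Sum>n<(2 ^ i)\<^sup>2. g n) / real ((2 ^ i)\<^sup>2)) \<longlonglongrightarrow> q"
  proof (rule filterlim_compose [of "\<lambda>n. (\<Sum>k<n. g k) / real n"])
    show "(\<lambda>n. (\<Sum>k<n. g k) / real n) \<longlonglongrightarrow> q"
      using q by (simp add: has_mean_def)
    show "filterlim (\<lambda>i::nat. (2 ^ i)\<^sup>2 :: nat) at_top sequentially"
      by (intro filterlim_subseq strict_monoI power_strict_mono) auto
  qed
  moreover have "real ((2 ^ i)\<^sup>2) = 4 ^ i" for i
    by (simp add: power2_eq_square flip: power_mult_distrib)
  ultimately have a: "a \<longlonglongrightarrow> q"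
    by (simp add: sum_square_blocks T_def a_def [abs_def] U_def del: of_nat_power sum.lessThan_Suc)
  have sub: "(\<lambda>i. a (2 * i)) \<longlonglongrightarrow> q" "(\<lambda>i. a (Suc (2 * i))) \<longlonglongrightarrow> q" "(\<lambda>i. a (2 * i + 2)) \<longlonglongrightarrow> q"
    by (rule filterlim_compose [OF a], real_asymp)+
  have quarter: "a (Suc (2 * i)) = a (2 * i) / 4" for i
  proof -
    have "(\<Sum>K\<in>{2 ^ (2 * i)..<2 ^ Suc (2 * i)}. T K) = 0"
      by (intro sum.neutral ballI T0) (metis fl even_mult_iff even_numeral)
    then have "U (Suc (2 * i)) = U (2 * i)"
      using U_Suc [of "2 * i"] by linarith
    then show ?thesis
      by (simp add: a_def)
  qed
  have "(\<lambda>i. a (2 * i) / 4) \<longlonglongrightarrow> q"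
    using sub(2) unfolding quarter .
  moreover have "(\<lambda>i. a (2 * i) / 4) \<longlonglongrightarrow> q / 4"
    by (rule tendsto_divide [OF sub(1) tendsto_const]) simp
  ultimately have "q = q / 4"
    by (rule LIMSEQ_unique)
  then have "q = 0" by simp
  \<comment> \<open>With \<open>m = 2 * i + 1\<close>, the range holds \<open>2 ^ m\<close> blocks
    contributing at least \<open>2 ^ m / 8\<close> each, and \<open>4 ^ m / 8\<close> divided by
    \<open>4 ^ (m + 1)\<close> is 1/32.\<close>
  have "a (2 * i + 2) \<ge> 1 / 32" if "K0 \<le> i" for i
  proof -
    define m where "m = 2 * i + 1"
    have "K0 \<le> 2 ^ m"
      using that less_exp [of m] by (simp add: m_def)
    have "(2::real) ^ m * (2 ^ m / 8) = (\<Sum>K\<in>{2 ^ m..<2 ^ Suc m :: nat}. 2 ^ m / 8)"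
      by simp
    also have "\<dots> \<le> (\<Sum>K\<in>{2 ^ m..<2 ^ Suc m}. T K)"
    proof (rule sum_mono)
      fix K assume K: "K \<in> {2 ^ m..<2 ^ Suc m :: nat}"
      then have "real K \<ge> 2 ^ m"
        by (metis atLeastLessThan_iff numeral_power_le_of_nat_cancel_iff)
      moreover have "T K \<ge> real K / 8"
        using K fl [OF K] \<open>K0 \<le> 2 ^ m\<close> by (intro K0) (auto simp: m_def)
      ultimately show "2 ^ m / 8 \<le> T K"
        by linarith
    qed
    also have "\<dots> \<le> U (Suc m)"
      using U_Suc [of m] sum_nonneg [of "{..<2 ^ m}" T] T_nonneg by (simp add: U_def)
    finally have "2 ^ m * 2 ^ m / 8 \<le> U (Suc m)"
      by simp
    then have "(4::real) ^ m / 8 \<le> U (Suc m)"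
      by (simp flip: power_mult_distrib)
    then have "1 / 32 \<le> a (Suc m)"
      by (simp add: a_def field_simps)
    then show ?thesis
      by (simp add: m_def)
  qed
  then have "1 / 32 \<le> q"
    using sub(3) by (intro tendsto_lowerbound [OF sub(3)]) (auto simp: eventually_sequentially)
  with \<open>q = 0\<close> show False
    by simp
qed

subsection \<open>The compact space and the map\<close>

text \<open>Entries 0 to 3 hold parity, side, position and height, with Booleans coded as 0 and 1;
  all further entries are 0, so the four coordinates determine the point.\<close>

definition pt :: "bool \<Rightarrow> bool \<Rightarrow> real \<Rightarrow> real \<Rightarrow> nat \<Rightarrow> real" where
  "pt i s t h = (\<lambda>_. 0)(0 := of_bool i, 1 := of_bool s, 2 := t, 3 := h)"

lemma pt_nth [simp]:
  "pt i s t h 0 = of_bool i" "pt i s t h (Suc 0) = of_bool s" "pt i s t h 2 = t" "pt i s t h 3 = h"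
  by (simp_all add: pt_def)

text \<open>Points of positive height are isolated and accumulate only at height 0, where all
  positions are present; this makes the space closed.\<close>

definition drift_space :: "(nat \<Rightarrow> real) set" where
  "drift_space = {pt i s t h | i s t h. 0 \<le> t \<and> t \<le> 1 \<and> (h = 0 \<or> (\<exists>m. h = 1 / real (Suc m) \<and> t = wave s m))}"

definition base_dist :: "bool \<Rightarrow> bool \<Rightarrow> real \<Rightarrow> bool \<Rightarrow> bool \<Rightarrow> real \<Rightarrow> real" where
  "base_dist i s t i' s' t' =
     (if i \<noteq> i' then 2 else if s = s' then \<bar>t - t'\<bar> else if i then 2 - \<bar>t - t'\<bar> else 1 + \<bar>t - t'\<bar>)"

text \<open>Heights lie in the unit interval, so across sides or parities, where the base distance
  is at least 1, the height has no influence on the maximum.\<close>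

definition drift_dist :: "(nat \<Rightarrow> real) \<Rightarrow> (nat \<Rightarrow> real) \<Rightarrow> real" where
  "drift_dist z z' = max (base_dist (z 0 = 1) (z 1 = 1) (z 2) (z' 0 = 1) (z' 1 = 1) (z' 2)) \<bar>z 3 - z' 3\<bar>"

text \<open>At height \<open>z 3 = 1 / (m + 1)\<close> the index of the next wave value is \<open>m + 1 = 1 / z 3\<close>.\<close>

definition drift_map :: "(nat \<Rightarrow> real) \<Rightarrow> nat \<Rightarrow> real" where
  "drift_map z = (if z 0 = 0 then z(0 := 1)
          else pt False (z 1 = 1) (if z 3 = 0 then z 2 else wave (z 1 = 1) (nat \<lfloor>1 / z 3\<rfloor>)) (z 3 / (1 + z 3)))"

lemma drift_dist_pt: "drift_dist (pt i s t h) (pt i' s' t' h') = max (base_dist i s t i' s' t') \<bar>h - h'\<bar>"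
  by (simp add: drift_dist_def)

lemma drift_map_pt:
  "drift_map (pt False s t h) = pt True s t h"
  "drift_map (pt True s t 0) = pt False s t 0"
  "drift_map (pt True s t (1 / real (Suc m))) = pt False s (wave s (Suc m)) (1 / real (Suc (Suc m)))"
proof -
  show "drift_map (pt False s t h) = pt True s t h" "drift_map (pt True s t 0) = pt False s t 0"
    by (auto simp: drift_map_def pt_def)
  have "nat \<lfloor>1 + real m\<rfloor> = Suc m"
    by (metis floor_of_nat nat_int of_nat_Suc)
  moreover have "1 / (1 + real m) / (1 + 1 / (1 + real m)) = 1 / (2 + real m)"
    by (simp add: field_simps)
  ultimately show "drift_map (pt True s t (1 / real (Suc m))) = pt False s (wave s (Suc m)) (1 / real (Suc (Suc m)))"
    by (simp add: drift_map_def)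
qed

section \<open>Metric axioms and compactness\<close>

lemma base_dist_le_2: "t \<in> {0..1} \<Longrightarrow> t' \<in> {0..1} \<Longrightarrow> base_dist i s t i' s' t' \<le> 2"
  by (auto simp: base_dist_def)

lemma base_dist_commute: "base_dist i s t i' s' t' = base_dist i' s' t' i s t"
  by (auto simp: base_dist_def)

text \<open>Distances across sides or parities lie between 1 and 2, so two crossings already cost
  the maximal distance 2. With a single crossing of sides, the distance is 1-Lipschitz in each
  position; a change of parity alone costs 2.\<close>

lemma base_dist_triangle:
  assumes "t \<in> {0..1}" "t' \<in> {0..1}" "t'' \<in> {0..1}"
  shows "base_dist i s t i'' s'' t'' \<le> base_dist i s t i' s' t' + base_dist i' s' t' i'' s'' t''"
  using assms unfolding base_dist_def by (auto split: if_splits)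

lemma base_dist_less_1:
  "t \<in> {0..1} \<Longrightarrow> t' \<in> {0..1} \<Longrightarrow> base_dist i s t i' s' t' < 1 \<Longrightarrow> i' = i \<and> s' = s"
  by (auto simp: base_dist_def split: if_splits)

lemma pt_in_drift_space:
  assumes "t \<in> {0..1}" "h = 0 \<or> (\<exists>m. h = 1 / real (Suc m) \<and> t = wave s m)"
  shows "pt i s t h \<in> drift_space"
  unfolding drift_space_def mem_Collect_eq using assms by (intro exI conjI refl) auto

lemma drift_space_cases:
  assumes "z \<in> drift_space"
  obtains i s t h where "z = pt i s t h" "t \<in> {0..1}" "h \<in> {0..1}"
    "h = 0 \<or> (\<exists>m. h = 1 / real (Suc m) \<and> t = wave s m)"
  using assms unfolding drift_space_def by fastforce

interpretation drift: Metric_space drift_space drift_dist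
proof
  fix x y z
  show "0 \<le> drift_dist x y"
    by (simp add: drift_dist_def le_max_iff_disj)
  show "drift_dist x y = drift_dist y x"
    by (simp add: drift_dist_def base_dist_commute [of "x 0 = 1"] abs_minus_commute)
  assume x: "x \<in> drift_space" and y: "y \<in> drift_space"
  then show "drift_dist x y = 0 \<longleftrightarrow> x = y"
  proof (elim drift_space_cases)
    fix i s t h i' s' t' h'
    assume a: "x = pt i s t h" "t \<in> {0..1}" "y = pt i' s' t' h'" "t' \<in> {0..1}"
    show ?thesis
    proof
      assume 0: "drift_dist x y = 0"
      then have b: "base_dist i s t i' s' t' \<le> 0" "\<bar>h - h'\<bar> \<le> 0"
        using a by (auto simp: drift_dist_pt max_def split: if_splits)
      then have "i' = i \<and> s' = s"
        using base_dist_less_1 [OF a(2,4), of i s i' s'] by linarith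
      then show "x = y"
        using a b by (simp add: base_dist_def)
    qed (simp add: a drift_dist_pt base_dist_def)
  qed
  assume z: "z \<in> drift_space"
  from x y z show "drift_dist x z \<le> drift_dist x y + drift_dist y z"
  proof (elim drift_space_cases)
    fix i s t h i' s' t' h' i'' s'' t'' h''
    assume a: "x = pt i s t h" "t \<in> {0..1}" "y = pt i' s' t' h'" "t' \<in> {0..1}"
      "z = pt i'' s'' t'' h''" "t'' \<in> {0..1}"
    have "base_dist i s t i'' s'' t'' \<le> drift_dist x y + drift_dist y z"
      using base_dist_triangle [OF a(2,4,6), of i s i'' s'' i' s'] a by (simp add: drift_dist_pt)
    moreover have "\<bar>h - h''\<bar> \<le> drift_dist x y + drift_dist y z"
      using abs_triangle_ineq [of "h - h'" "h' - h''"] a by (simp add: drift_dist_pt)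
    ultimately show ?thesis
      using a by (simp add: drift_dist_pt)
  qed
qed

text \<open>A subsequence converges in all four coordinates, with parity and side eventually
  constant. A limit at height 0 may have any position; at positive limit height the subsequence has
  eventually constant height and position.\<close>

lemma drift_space_compact: "compact_space drift.mtopology"
  unfolding drift.compact_space_sequentially
proof (intro allI impI)
  fix \<sigma> :: "nat \<Rightarrow> nat \<Rightarrow> real"
  assume "range \<sigma> \<subseteq> drift_space"
  then have "\<forall>n. \<exists>i s t h. \<sigma> n = pt i s t h \<and> t \<in> {0..1} \<and> h \<in> {0..1} \<and>
      (h = 0 \<or> (\<exists>m. h = 1 / real (Suc m) \<and> t = wave s m))"
    by (metis drift_space_cases range_subsetD)
  then obtain i s t h where \<sigma>: "\<And>n. \<sigma> n = pt (i n) (s n) (t n) (h n)"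
    and t: "\<And>n. t n \<in> {0..1}" and h: "\<And>n. h n \<in> {0..1}"
    and w: "\<And>n. h n = 0 \<or> (\<exists>m. h n = 1 / real (Suc m) \<and> t n = wave (s n) m)"
    by metis
  define q where "q n = ((of_bool (i n) :: real, of_bool (s n) :: real), (t n, h n))" for n :: nat
  have "range q \<subseteq> ({0..1 :: real} \<times> {0..1 :: real}) \<times> ({0..1 :: real} \<times> {0..1 :: real})"
    using t h by (auto simp: q_def)
  moreover have "bounded (({0..1 :: real} \<times> {0..1 :: real}) \<times> ({0..1 :: real} \<times> {0..1 :: real}))"
    by (intro bounded_Times compact_imp_bounded compact_Icc)
  ultimately have "bounded (range q)"
    using bounded_subset by blast
  then obtain l r where r: "strict_mono r" and l: "(q \<circ> r) \<longlonglongrightarrow> l"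
    using bounded_imp_convergent_subsequence by blast
  obtain li ls lt lh where lq: "l = ((li, ls), (lt, lh))"
    by (metis prod.exhaust)
  have li: "(\<lambda>n. of_bool (i (r n))) \<longlonglongrightarrow> li"
    using tendsto_fst [OF tendsto_fst [OF l]] by (simp add: lq q_def o_def)
  have ls: "(\<lambda>n. of_bool (s (r n))) \<longlonglongrightarrow> ls"
    using tendsto_snd [OF tendsto_fst [OF l]] by (simp add: lq q_def o_def)
  have lt: "(\<lambda>n. t (r n)) \<longlonglongrightarrow> lt"
    using tendsto_fst [OF tendsto_snd [OF l]] by (simp add: lq q_def o_def)
  have lh: "(\<lambda>n. h (r n)) \<longlonglongrightarrow> lh"
    using tendsto_snd [OF tendsto_snd [OF l]] by (simp add: lq q_def o_def)
  \<comment> \<open>A convergent sequence of zeros and ones is eventually constant.\<close>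
  have ev: "\<exists>c. \<forall>\<^sub>F n in sequentially. b n = c" if "(\<lambda>n. of_bool (b n)) \<longlonglongrightarrow> (x::real)" for b x
  proof (cases "x < 1 / 2")
    case True
    then have "\<forall>\<^sub>F n in sequentially. of_bool (b n) < (1 / 2 :: real)"
      using order_tendstoD(2) [OF that] by blast
    then have "\<forall>\<^sub>F n in sequentially. b n = False"
      by eventually_elim (auto simp: of_bool_def split: if_splits)
    then show ?thesis by blast
  next
    case False
    then have "\<forall>\<^sub>F n in sequentially. of_bool (b n) > (0 :: real)"
      using order_tendstoD(1) [OF that, of 0] by simp
    then have "\<forall>\<^sub>F n in sequentially. b n = True"
      by eventually_elim auto
    then show ?thesis by blast
  qed
  obtain ci where ci: "\<forall>\<^sub>F n in sequentially. i (r n) = ci"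
    using ev [OF li] by blast
  obtain cs where cs: "\<forall>\<^sub>F n in sequentially. s (r n) = cs"
    using ev [OF ls] by blast
  have lt01: "lt \<in> {0..1}"
    by (rule closed_sequentially [OF closed_atLeastAtMost _ lt]) (use t in auto)
  have lh01: "lh \<in> {0..1}"
    by (rule closed_sequentially [OF closed_atLeastAtMost _ lh]) (use h in auto)
  have "pt ci cs lt lh \<in> drift_space"
  proof (cases "lh = 0")
    case True
    then show ?thesis
      using lt01 by (auto intro!: pt_in_drift_space)
  next
    case False
    then have pos: "lh > 0"
      using lh01 by auto
    then have inv: "(\<lambda>n. 1 / h (r n)) \<longlonglongrightarrow> 1 / lh"
      by (intro tendsto_intros lh) simp
    have hp: "\<forall>\<^sub>F n in sequentially. h (r n) > 0"
      using order_tendstoD(1) [OF lh pos] .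
    have "\<forall>\<^sub>F n in sequentially. dist (1 / h (r n)) (1 / lh) < 1 / 2"
      using tendstoD [OF inv, of "1 / 2"] by simp
    with hp cs have "\<forall>\<^sub>F n in sequentially. \<exists>m. h (r n) = 1 / real (Suc m) \<and> t (r n) = wave cs m
        \<and> \<bar>real (Suc m) - 1 / lh\<bar> < 1 / 2"
    proof eventually_elim
      case (elim n)
      then obtain m where "h (r n) = 1 / real (Suc m)" "t (r n) = wave (s (r n)) m"
        using w [of "r n"] by auto
      then show ?case
        using elim by (auto simp: dist_real_def intro!: exI [of _ m])
    qed
    then obtain N where N: "\<And>n. n \<ge> N \<Longrightarrow> \<exists>m. h (r n) = 1 / real (Suc m) \<and> t (r n) = wave cs m
        \<and> \<bar>real (Suc m) - 1 / lh\<bar> < 1 / 2"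
      by (auto simp: eventually_sequentially)
    then obtain m where m: "\<bar>real (Suc m) - 1 / lh\<bar> < 1 / 2"
      by blast
    \<comment> \<open>Two integers within 1/2 of the same real number differ by less than 1.\<close>
    have uniq: "m' = m" if "\<bar>real (Suc m') - 1 / lh\<bar> < 1 / 2" for m'
    proof -
      have "\<bar>real m' - real m\<bar> < 1"
        using that m by linarith
      then show ?thesis
        by linarith
    qed
    have hm: "h (r n) = 1 / real (Suc m)" "t (r n) = wave cs m" if "n \<ge> N" for n
      using N [OF that] uniq by auto
    have "lh = 1 / real (Suc m)"
      by (rule LIMSEQ_unique [OF lh tendsto_eventually])
         (use hm(1) in \<open>auto simp: eventually_sequentially\<close>)
    moreover have "lt = wave cs m"
      by (rule LIMSEQ_unique [OF lt tendsto_eventually])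
         (use hm(2) in \<open>auto simp: eventually_sequentially\<close>)
    ultimately show ?thesis
      using lt01 by (auto intro!: pt_in_drift_space)
  qed
  moreover have "limitin drift.mtopology (\<sigma> \<circ> r) (pt ci cs lt lh) sequentially"
    unfolding drift.limitin_metric_dist_null
  proof (intro conjI)
    show "pt ci cs lt lh \<in> drift_space" by fact
    show "\<forall>\<^sub>F n in sequentially. (\<sigma> \<circ> r) n \<in> drift_space"
      using \<open>range \<sigma> \<subseteq> drift_space\<close> by (intro always_eventually) auto
    have "(\<lambda>n. max \<bar>t (r n) - lt\<bar> \<bar>h (r n) - lh\<bar>) \<longlonglongrightarrow> max \<bar>lt - lt\<bar> \<bar>lh - lh\<bar>"
      by (intro tendsto_intros lt lh)
    then have "(\<lambda>n. max \<bar>t (r n) - lt\<bar> \<bar>h (r n) - lh\<bar>) \<longlonglongrightarrow> 0"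
      by simp
    moreover have "\<forall>\<^sub>F n in sequentially. max \<bar>t (r n) - lt\<bar> \<bar>h (r n) - lh\<bar> = drift_dist ((\<sigma> \<circ> r) n) (pt ci cs lt lh)"
      using ci cs by eventually_elim (simp add: \<sigma> drift_dist_pt base_dist_def)
    ultimately show "(\<lambda>n. drift_dist ((\<sigma> \<circ> r) n) (pt ci cs lt lh)) \<longlonglongrightarrow> 0"
      by (rule Lim_transform_eventually)
  qed
  ultimately show "\<exists>l r. l \<in> drift_space \<and> strict_mono r \<and> limitin drift.mtopology (\<sigma> \<circ> r) l sequentially"
    using r by blast
qed

section \<open>Continuity of the map\<close>

lemma drift_map_in_drift_space:
  assumes "z \<in> drift_space"
  shows "drift_map z \<in> drift_space"
  using assms
proof (elim drift_space_cases)
  fix i s t h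
  assume a: "z = pt i s t h" "t \<in> {0..1}" "h = 0 \<or> (\<exists>m. h = 1 / real (Suc m) \<and> t = wave s m)"
  show ?thesis
  proof (cases i)
    case True
    from a(3) show ?thesis
    proof (elim disjE exE conjE)
      assume "h = 0"
      then have "drift_map z = pt False s t 0"
        using True a(1) by (simp add: drift_map_pt)
      then show ?thesis
        using a(2) by (auto simp: drift_space_def)
    next
      fix m assume "h = 1 / real (Suc m)"
      then have "drift_map z = pt False s (wave s (Suc m)) (1 / real (Suc (Suc m)))"
        using True a(1) by (simp only: drift_map_pt)
      then show ?thesis
        using wave_bounds unfolding drift_space_def by blast
    qed
  next
    case False
    then show ?thesis
      using a by (simp add: drift_map_pt pt_in_drift_space del: of_nat_Suc)
  qed
qed

text \<open>Within distance 1 parity and side are fixed. At parity \<open>False\<close> the map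
  preserves such small distances. At parity \<open>True\<close>, points near height 0 have large
  wave index and hence a small wave step, and points of positive height are isolated.\<close>

lemma drift_map_continuous: "continuous_map drift.mtopology drift.mtopology drift_map"
  unfolding drift.metric_continuous_map [OF drift.Metric_space_axioms]
proof (intro conjI ballI allI impI)
  show "drift_map ` drift_space \<subseteq> drift_space"
    using drift_map_in_drift_space by blast
  fix a \<epsilon> assume a: "a \<in> drift_space" and \<epsilon>: "(0::real) < \<epsilon>"
  from a obtain i s t h where a': "a = pt i s t h" "t \<in> {0..1}" "h \<in> {0..1}"
    "h = 0 \<or> (\<exists>m. h = 1 / real (Suc m) \<and> t = wave s m)"
    by (rule drift_space_cases)
  have near: "\<exists>t' h'. x = pt i s t' h' \<and> t' \<in> {0..1} \<and> \<bar>t - t'\<bar> < \<delta> \<and> \<bar>h - h'\<bar> < \<delta> \<and>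
      (h' = 0 \<or> (\<exists>m. h' = 1 / real (Suc m) \<and> t' = wave s m))"
    if "x \<in> drift_space" "drift_dist a x < \<delta>" "\<delta> \<le> 1" for x \<delta>
    using that(1)
  proof (elim drift_space_cases)
    fix i' s' t' h'
    assume x: "x = pt i' s' t' h'" "t' \<in> {0..1}" "h' = 0 \<or> (\<exists>m. h' = 1 / real (Suc m) \<and> t' = wave s' m)"
    then have b: "base_dist i s t i' s' t' < \<delta>" "\<bar>h - h'\<bar> < \<delta>"
      using that(2) a' by (auto simp: drift_dist_pt)
    then have "i' = i \<and> s' = s"
      using base_dist_less_1 [OF a'(2) x(2), of i s i' s'] that(3) by linarith
    then show ?thesis
      using x b by (auto simp: base_dist_def)
  qed
  show "\<exists>\<delta>>0. \<forall>x. x \<in> drift_space \<and> drift_dist a x < \<delta> \<longrightarrow> drift_dist (drift_map a) (drift_map x) < \<epsilon>"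
  proof (cases i)
    case False
    show ?thesis
    proof (intro exI [of _ "min 1 \<epsilon>"] conjI allI impI)
      fix x assume "x \<in> drift_space \<and> drift_dist a x < min 1 \<epsilon>"
      then obtain t' h' where "x = pt i s t' h'" "\<bar>t - t'\<bar> < min 1 \<epsilon>" "\<bar>h - h'\<bar> < min 1 \<epsilon>"
        using near [of x "min 1 \<epsilon>"] by auto
      then show "drift_dist (drift_map a) (drift_map x) < \<epsilon>"
        using False by (simp add: a' drift_map_pt drift_dist_pt base_dist_def)
    qed (use \<epsilon> in simp)
  next
    case True
    from a'(4) show ?thesis
    proof (elim disjE exE conjE)
      assume h0: "h = 0"
      have "\<forall>\<^sub>F m in sequentially. \<bar>wave s (Suc m) - wave s m\<bar> < \<epsilon> / 2"
        using tendstoD [OF wave_step [of s], of "\<epsilon> / 2"] \<epsilon> by (simp add: dist_real_def)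
      then obtain M where M: "\<And>m. m \<ge> M \<Longrightarrow> \<bar>wave s (Suc m) - wave s m\<bar> < \<epsilon> / 2"
        by (auto simp: eventually_sequentially)
      \<comment> \<open>One half of \<open>\<epsilon>\<close> is for the distance of the positions,
        the other for the wave step; the first bound forces the wave index beyond
        \<open>M\<close>.\<close>
      define \<delta> where "\<delta> = min (1 / real (Suc M)) (\<epsilon> / 2)"
      have \<delta>: "0 < \<delta>" "\<delta> \<le> 1" "\<delta> \<le> \<epsilon> / 2" "\<delta> \<le> 1 / real (Suc M)"
        using \<epsilon> by (auto simp: \<delta>_def min_le_iff_disj)
      show ?thesis
      proof (intro exI [of _ \<delta>] conjI allI impI)
        fix x assume "x \<in> drift_space \<and> drift_dist a x < \<delta>"
        then obtain t' h' where x: "x = pt i s t' h'" "\<bar>t - t'\<bar> < \<delta>" "\<bar>h - h'\<bar> < \<delta>"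
          "h' = 0 \<or> (\<exists>m. h' = 1 / real (Suc m) \<and> t' = wave s m)"
          using near [of x \<delta>] \<delta> by auto
        have Fa: "drift_map a = pt False s t 0"
          using True h0 by (simp add: a' drift_map_pt)
        from x(4) show "drift_dist (drift_map a) (drift_map x) < \<epsilon>"
        proof (elim disjE exE conjE)
          assume "h' = 0"
          then show ?thesis
            using True x \<delta> \<epsilon> Fa by (simp add: drift_map_pt drift_dist_pt base_dist_def)
        next
          fix m assume m: "h' = 1 / real (Suc m)" "t' = wave s m"
          have "1 / real (Suc m) < 1 / real (Suc M)"
            using x(3) h0 m \<delta> by simp
          then have "M \<le> m"
            by (simp add: field_simps)
          have "\<bar>t - wave s (Suc m)\<bar> < \<epsilon>"
            using M [OF \<open>M \<le> m\<close>] x(2) m(2) \<delta>(3) by linarith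
          moreover have "1 / real (Suc (Suc m)) < \<epsilon>"
          proof -
            have "1 / real (Suc (Suc m)) \<le> 1 / real (Suc m)"
              by (simp add: field_simps)
            also have "\<dots> < \<epsilon>"
              using x(3) h0 m \<delta> \<epsilon> by simp
            finally show ?thesis .
          qed
          moreover have "drift_map x = pt False s (wave s (Suc m)) (1 / real (Suc (Suc m)))"
            using True x m by (simp only: drift_map_pt)
          ultimately show ?thesis
            by (simp add: Fa drift_dist_pt base_dist_def)
        qed
      qed (use \<delta> in simp)
    next
      fix m assume m: "h = 1 / real (Suc m)" "t = wave s m"
      \<comment> \<open>The gap to the next lower height; by convexity of the reciprocal the gap
        above is at least as large, so the ball contains only \<open>a\<close>.\<close>
      define \<delta> where "\<delta> = 1 / real (Suc m) - 1 / real (Suc (Suc m))"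
      have "\<delta> \<le> 1 / real (Suc m)" "1 / real (Suc m) \<le> 1"
        by (simp_all add: \<delta>_def)
      then have \<delta>: "0 < \<delta>" "\<delta> \<le> 1"
        by (simp add: \<delta>_def divide_simps, linarith)
      show ?thesis
      proof (intro exI [of _ \<delta>] conjI allI impI)
        fix x assume "x \<in> drift_space \<and> drift_dist a x < \<delta>"
        then obtain t' h' where x: "x = pt i s t' h'" "\<bar>h - h'\<bar> < \<delta>"
          "h' = 0 \<or> (\<exists>m. h' = 1 / real (Suc m) \<and> t' = wave s m)"
          using near [of x \<delta>] \<delta> by auto
        have "h' > 1 / real (Suc (Suc m))"
          using x(2) m by (simp add: \<delta>_def abs_less_iff)
        then have "h' \<noteq> 0"
          by (metis less_irrefl of_nat_0_less_iff zero_less_Suc zero_less_divide_1_iff order_less_trans)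
        then obtain m' where m': "h' = 1 / real (Suc m')" "t' = wave s m'"
          using x(3) by blast
        have "m' \<le> m"
          using \<open>h' > 1 / real (Suc (Suc m))\<close> m' by (simp add: field_simps)
        moreover have "m' \<ge> m"
        proof (rule ccontr)
          assume "\<not> ?thesis"
          then have m'': "real (Suc m') \<le> real m" "real m > 0"
            by simp_all
          have "1 / real m \<le> 1 / real (Suc m')"
            using m'' by (intro divide_left_mono) auto
          moreover have "1 / y - 1 / (y + 1) \<ge> 1 / (y + 1) - 1 / (y + 2)" if "y > 0" for y :: real
            using that by (simp add: divide_simps)
          from this [OF m''(2)] have "1 / real m - 1 / real (Suc m) \<ge> \<delta>"
            by (simp add: \<delta>_def add.commute)
          ultimately have "1 / real (Suc m') - 1 / real (Suc m) \<ge> \<delta>"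
            by linarith
          then show False
            using x(2) m m' by (simp add: abs_less_iff)
        qed
        ultimately have "x = a"
          using x(1) m m' a'(1) by simp
        then show "drift_dist (drift_map a) (drift_map x) < \<epsilon>"
          using \<epsilon> drift.mdist_zero drift_map_in_drift_space a by simp
      qed (use \<delta> in simp)
    qed
  qed
qed

subsection \<open>Distribution functions\<close>

text \<open>Positions and heights along every second iterate: constant at height 0, or a wave
  entered at index \<open>m\<close>.\<close>

definition slow_orbit :: "bool \<Rightarrow> (nat \<Rightarrow> real) \<Rightarrow> (nat \<Rightarrow> real) \<Rightarrow> bool" where
  "slow_orbit s \<tau> \<eta> \<longleftrightarrow> (\<exists>t\<in>{0..1}. \<tau> = (\<lambda>k. t) \<and> \<eta> = (\<lambda>k. 0)) \<or>
     (\<exists>m. \<tau> = (\<lambda>k. wave s (m + k)) \<and> \<eta> = (\<lambda>k. 1 / real (Suc (m + k))))"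

lemma slow_orbit_bounds:
  assumes "slow_orbit s \<tau> \<eta>"
  shows "\<tau> k \<in> {0..1}" "\<eta> k \<in> {0..1}"
  using assms by (auto simp: slow_orbit_def wave_bounds)

lemma slow_orbit_step:
  assumes "slow_orbit s \<tau> \<eta>"
  shows "drift_map (pt True s (\<tau> k) (\<eta> k)) = pt False s (\<tau> (Suc k)) (\<eta> (Suc k))"
  using assms unfolding slow_orbit_def by (auto simp: drift_map_pt simp del: of_nat_Suc)

lemma drift_space_slow_orbit:
  assumes "z \<in> drift_space"
  obtains i s \<tau> \<eta> where "slow_orbit s \<tau> \<eta>" "z = pt i s (\<tau> 0) (\<eta> 0)"
  using assms
proof (elim drift_space_cases)
  fix i s t h
  assume a: "z = pt i s t h" "t \<in> {0..1}" "h = 0 \<or> (\<exists>m. h = 1 / real (Suc m) \<and> t = wave s m)"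
  from a(3) show thesis
  proof (elim disjE exE conjE)
    assume "h = 0"
    have "slow_orbit s (\<lambda>k. t) (\<lambda>k. 0)"
      using a(2) by (auto simp: slow_orbit_def)
    then show thesis
      by (rule that) (simp add: a(1) \<open>h = 0\<close>)
  next
    fix m assume m: "h = 1 / real (Suc m)" "t = wave s m"
    have "slow_orbit s (\<lambda>k. wave s (m + k)) (\<lambda>k. 1 / real (Suc (m + k)))"
      by (auto simp: slow_orbit_def)
    then show thesis
      by (rule that) (simp add: a(1) m)
  qed
qed

lemma drift_map_funpow_False:
  assumes "slow_orbit s \<tau> \<eta>"
  shows "(drift_map ^^ k) (pt False s (\<tau> 0) (\<eta> 0)) = pt (odd k) s (\<tau> (k div 2)) (\<eta> (k div 2))"
proof (induction k)
  case (Suc k)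
  show ?case
  proof (cases "even k")
    case True
    then show ?thesis
      using Suc by (simp add: drift_map_pt)
  next
    case False
    then have "Suc k div 2 = Suc (k div 2)"
      by presburger
    with False show ?thesis
      using Suc slow_orbit_step [OF assms, of "k div 2"] by simp
  qed
qed simp

text \<open>A point of parity \<open>True\<close> is the image of its copy of parity
  \<open>False\<close>, so its orbit is a shift of one already described.\<close>

lemma drift_map_funpow_True: "(drift_map ^^ k) (pt True s t h) = (drift_map ^^ Suc k) (pt False s t h)"
  by (simp add: drift_map_pt funpow_swap1)

section \<open>Frequencies of distances between two orbits\<close>

lemma has_mean_const_dominated:
  assumes "has_mean g 0" "\<And>k. \<bar>c k - a\<bar> \<le> g k"
  shows "has_mean c a"
  using has_mean_dominated [OF assms(1) has_mean_const assms(2)] .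

lemma wave_transition_mean_shift:
  "has_mean (\<lambda>k. of_bool (wave s (m + k) \<noteq> 0 \<and> wave s (m + k) \<noteq> 1)) 0"
  using wave_transition_mean has_mean_shift_iff [of "\<lambda>n. of_bool (wave s n \<noteq> 0 \<and> wave s n \<noteq> 1)"] by blast

text \<open>Outside density 0 a wave rests at 0 or 1. Against a constant \<open>t\<close> the gap is
  then \<open>t\<close> or \<open>1 - t\<close>, between two waves it is 0 or 1, and between two
  constants it never changes.\<close>

lemma slow_orbit_gap_mode:
  assumes "slow_orbit s \<tau> \<eta>" "slow_orbit s' \<tau>' \<eta>'"
  obtains e where "has_mean (\<lambda>k. of_bool (\<bar>\<tau> k - \<tau>' k\<bar> \<noteq> e \<and> \<bar>\<tau> k - \<tau>' k\<bar> \<noteq> 1 - e)) 0"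
proof -
  have mixed: "has_mean (\<lambda>k. of_bool (\<bar>wave s (m + k) - t\<bar> \<noteq> t \<and> \<bar>wave s (m + k) - t\<bar> \<noteq> 1 - t)) 0"
    if "t \<in> {0..1}" for s m t
    by (rule has_mean_0_dominated [OF wave_transition_mean_shift [of s m]])
       (use that in \<open>auto simp: of_bool_def\<close>)
  consider (const) t t' where "\<tau> = (\<lambda>k. t)" "\<tau>' = (\<lambda>k. t')"
    | (left) m t' where "\<tau> = (\<lambda>k. wave s (m + k))" "\<tau>' = (\<lambda>k. t')" "t' \<in> {0..1}"
    | (right) t m where "\<tau> = (\<lambda>k. t)" "\<tau>' = (\<lambda>k. wave s' (m + k))" "t \<in> {0..1}"
    | (both) m m' where "\<tau> = (\<lambda>k. wave s (m + k))" "\<tau>' = (\<lambda>k. wave s' (m' + k))"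
    using assms unfolding slow_orbit_def by blast
  then show thesis
  proof cases
    case const
    then show thesis
      using that [of "\<bar>t - t'\<bar>"] has_mean_const [of 0] by simp
  next
    case left
    then show thesis
      using that [of t'] mixed by simp
  next
    case right
    then show thesis
      using that [of t] mixed by (simp add: abs_minus_commute)
  next
    case both
    have "has_mean (\<lambda>k. of_bool (\<bar>wave s (m + k) - wave s' (m' + k)\<bar> \<noteq> 0 \<and>
        \<bar>wave s (m + k) - wave s' (m' + k)\<bar> \<noteq> 1 - 0)) 0"
    proof (rule has_mean_0_dominated)
      show "has_mean (\<lambda>k. of_bool (wave s (m + k) \<noteq> 0 \<and> wave s (m + k) \<noteq> 1)
          + of_bool (wave s' (m' + k) \<noteq> 0 \<and> wave s' (m' + k) \<noteq> 1)) 0"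
        using has_mean_add [OF wave_transition_mean_shift [of s m] wave_transition_mean_shift [of s' m']]
        by simp
    qed (auto simp: of_bool_def)
    then show thesis
      using that [of 0] both by simp
  qed
qed

text \<open>A fixed delay is a fixed number of wave steps, each tending to 0. Hence two descending
  orbits on the same side are asymptotic.\<close>

lemma wave_drift: "(\<lambda>k. wave s (m + k) - wave s (m' + k)) \<longlonglongrightarrow> 0"
proof -
  have *: "(\<lambda>k. wave s (m + k) - wave s k) \<longlonglongrightarrow> 0" for m
  proof (induction m)
    case (Suc m)
    have "(\<lambda>k. wave s (Suc (m + k)) - wave s (m + k)) \<longlonglongrightarrow> 0"
      using LIMSEQ_ignore_initial_segment [OF wave_step [of s], of m] by (simp add: add.commute)
    from tendsto_add [OF this Suc] show ?case
      by simp
  qed simp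
  from tendsto_diff [OF * [of m] * [of m']] show ?thesis
    by simp
qed

text \<open>The wave is at 0 and at 1 with density one half each, so the frequency of positions near
  \<open>t\<close> converges; the height eventually drops below \<open>\<delta>\<close>.\<close>

lemma wave_near_mean:
  "\<exists>l. has_mean (\<lambda>k. of_bool (max \<bar>wave s (m + k) - t\<bar> \<bar>1 / real (Suc (m + k))\<bar> < \<delta>)) l"
  if "\<delta> > 0"
proof -
  have "has_mean (\<lambda>n. of_bool (\<bar>0 - t\<bar> < \<delta>) * of_bool (wave s n = 0)
      + of_bool (\<bar>1 - t\<bar> < \<delta>) * of_bool (wave s n = 1))
      (of_bool (\<bar>0 - t\<bar> < \<delta>) * (1 / 2) + of_bool (\<bar>1 - t\<bar> < \<delta>) * (1 / 2))" (is "has_mean ?c ?l")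
    by (intro has_mean_add has_mean_cmult wave_zero_mean wave_one_mean)
  moreover have "\<bar>of_bool (\<bar>wave s n - t\<bar> < \<delta>) - ?c n\<bar> \<le> of_bool (wave s n \<noteq> 0 \<and> wave s n \<noteq> 1)" for n
    by (auto simp: of_bool_def)
  ultimately have "has_mean (\<lambda>n. of_bool (\<bar>wave s n - t\<bar> < \<delta>)) ?l"
    by (rule has_mean_dominated [OF wave_transition_mean [of s]])
  then have "has_mean (\<lambda>n. of_bool (max \<bar>wave s n - t\<bar> \<bar>1 / real (Suc n)\<bar> < \<delta>)) ?l"
  proof (rule has_mean_eventually)
    have "(\<lambda>n. 1 / real (Suc n)) \<longlonglongrightarrow> 0"
      by real_asymp
    then have "\<forall>\<^sub>F n in sequentially. 1 / real (Suc n) < \<delta>"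
      using order_tendstoD(2) that by blast
    then show "\<forall>\<^sub>F n in sequentially. of_bool (\<bar>wave s n - t\<bar> < \<delta>)
        = (of_bool (max \<bar>wave s n - t\<bar> \<bar>1 / real (Suc n)\<bar> < \<delta>) :: real)"
      by eventually_elim simp
  qed
  then show ?thesis
    using has_mean_shift_iff [of "\<lambda>n. of_bool (max \<bar>wave s n - t\<bar> \<bar>1 / real (Suc n)\<bar> < \<delta>)" m] by blast
qed

lemma same_side_mean:
  assumes "slow_orbit s \<tau> \<eta>" "slow_orbit s \<tau>' \<eta>'" "\<delta> > 0"
  shows "\<exists>l. has_mean (\<lambda>k. of_bool (max \<bar>\<tau> k - \<tau>' k\<bar> \<bar>\<eta> k - \<eta>' k\<bar> < \<delta>)) l"
proof -
  consider (const) t t' where "\<tau> = (\<lambda>k. t)" "\<eta> = (\<lambda>k. 0)" "\<tau>' = (\<lambda>k. t')" "\<eta>' = (\<lambda>k. 0)"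
    | (left) m t' where "\<tau> = (\<lambda>k. wave s (m + k))" "\<eta> = (\<lambda>k. 1 / real (Suc (m + k)))"
        "\<tau>' = (\<lambda>k. t')" "\<eta>' = (\<lambda>k. 0)"
    | (right) t m where "\<tau> = (\<lambda>k. t)" "\<eta> = (\<lambda>k. 0)"
        "\<tau>' = (\<lambda>k. wave s (m + k))" "\<eta>' = (\<lambda>k. 1 / real (Suc (m + k)))"
    | (both) m m' where "\<tau> = (\<lambda>k. wave s (m + k))" "\<eta> = (\<lambda>k. 1 / real (Suc (m + k)))"
        "\<tau>' = (\<lambda>k. wave s (m' + k))" "\<eta>' = (\<lambda>k. 1 / real (Suc (m' + k)))"
    using assms(1,2) unfolding slow_orbit_def by blast
  then show ?thesis
  proof cases
    case const
    show ?thesis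
      unfolding const by (rule exI) (rule has_mean_const)
  next
    case left
    then show ?thesis
      using wave_near_mean [OF assms(3), of s m t'] by simp
  next
    case right
    then show ?thesis
      using wave_near_mean [OF assms(3), of s m t] by (simp add: abs_minus_commute)
  next
    case both
    have "(\<lambda>k. 1 / real (Suc (m + k)) - 1 / real (Suc (m' + k))) \<longlonglongrightarrow> 0"
      by real_asymp
    then have "(\<lambda>k. max \<bar>\<tau> k - \<tau>' k\<bar> \<bar>\<eta> k - \<eta>' k\<bar>) \<longlonglongrightarrow> max \<bar>0\<bar> \<bar>0\<bar>"
      unfolding both by (intro tendsto_intros wave_drift)
    then have "\<forall>\<^sub>F k in sequentially. max \<bar>\<tau> k - \<tau>' k\<bar> \<bar>\<eta> k - \<eta>' k\<bar> < \<delta>"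
      using order_tendstoD(2) assms(3) by fastforce
    then have "\<forall>\<^sub>F k in sequentially. 1 = (of_bool (max \<bar>\<tau> k - \<tau>' k\<bar> \<bar>\<eta> k - \<eta>' k\<bar> < \<delta>) :: real)"
      by eventually_elim simp
    then show ?thesis
      by (intro exI) (rule has_mean_eventually [OF has_mean_const])
  qed
qed

text \<open>Iterates \<open>2 * k\<close> and \<open>2 * k + 1\<close> share the same position and
  height but differ in parity, so means are taken over such pairs. On one side both indicators
  agree; across the sides their sum is constant outside density 0.\<close>

lemma in_phase_mean:
  assumes "slow_orbit s \<tau> \<eta>" "slow_orbit s' \<tau>' \<eta>'" "\<delta> > 0"
  shows "\<exists>l. has_mean (\<lambda>k. of_bool (drift_dist ((drift_map ^^ k) (pt False s (\<tau> 0) (\<eta> 0)))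
           ((drift_map ^^ k) (pt False s' (\<tau>' 0) (\<eta>' 0))) < \<delta>)) l"
proof -
  define c :: "nat \<Rightarrow> real" where
    "c k = of_bool (drift_dist ((drift_map ^^ k) (pt False s (\<tau> 0) (\<eta> 0))) ((drift_map ^^ k) (pt False s' (\<tau>' 0) (\<eta>' 0))) < \<delta>)" for k
  define e where "e k = \<bar>\<tau> k - \<tau>' k\<bar>" for k
  have eta: "\<bar>\<eta> k - \<eta>' k\<bar> \<le> 1" and e: "0 \<le> e k" "e k \<le> 1" for k
    using slow_orbit_bounds [OF assms(1), of k] slow_orbit_bounds [OF assms(2), of k]
    by (auto simp: e_def abs_le_iff)
  have "\<exists>l. has_mean (\<lambda>k. c (2 * k) + c (2 * k + 1)) l"
  proof (cases "s = s'")
    case True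
    have "c (2 * k) + c (2 * k + 1) = 2 * of_bool (max \<bar>\<tau> k - \<tau>' k\<bar> \<bar>\<eta> k - \<eta>' k\<bar> < \<delta>)" for k
      unfolding c_def drift_map_funpow_False [OF assms(1)] drift_map_funpow_False [OF assms(2)]
      using True by (simp add: drift_dist_pt base_dist_def)
    moreover obtain l where "has_mean (\<lambda>k. of_bool (max \<bar>\<tau> k - \<tau>' k\<bar> \<bar>\<eta> k - \<eta>' k\<bar> < \<delta>)) l"
      using same_side_mean [OF assms(1)] assms(2,3) True by blast
    ultimately show ?thesis
      using has_mean_cmult [of _ l 2] by auto
  next
    case False
    have c: "c (2 * k) + c (2 * k + 1) = of_bool (1 + e k < \<delta>) + of_bool (2 - e k < \<delta>)" for k
    proof -
      have "max (1 + e k) \<bar>\<eta> k - \<eta>' k\<bar> = 1 + e k" "max (2 - e k) \<bar>\<eta> k - \<eta>' k\<bar> = 2 - e k"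
        using eta [of k] e [of k] by (simp_all only: max_absorb1)
      then show ?thesis
        unfolding c_def drift_map_funpow_False [OF assms(1)] drift_map_funpow_False [OF assms(2)]
        using False by (simp add: drift_dist_pt base_dist_def e_def [symmetric])
    qed
    obtain a where "has_mean (\<lambda>k. of_bool (e k \<noteq> a \<and> e k \<noteq> 1 - a)) 0"
      using slow_orbit_gap_mode [OF assms(1,2)] by (auto simp: e_def)
    then have "has_mean (\<lambda>k. 2 * of_bool (e k \<noteq> a \<and> e k \<noteq> 1 - a)) 0"
      using has_mean_cmult [of _ 0 2] by fastforce
    \<comment> \<open>Replacing \<open>a\<close> by \<open>1 - a\<close> exchanges
      \<open>1 + a\<close> and \<open>2 - a\<close>, so both possible gaps give the same
      sum.\<close>
    then have "has_mean (\<lambda>k. c (2 * k) + c (2 * k + 1)) (of_bool (1 + a < \<delta>) + of_bool (2 - a < \<delta>))"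
    proof (rule has_mean_const_dominated)
      show "\<bar>c (2 * k) + c (2 * k + 1) - (of_bool (1 + a < \<delta>) + of_bool (2 - a < \<delta>))\<bar>
          \<le> 2 * of_bool (e k \<noteq> a \<and> e k \<noteq> 1 - a)" for k
        unfolding c by (auto simp: of_bool_def)
    qed
    then show ?thesis
      by blast
  qed
  then obtain l where "has_mean (\<lambda>k. c (2 * k) + c (2 * k + 1)) l"
    by blast
  then have "has_mean c (l / 2)"
    by (rule has_mean_pairs) (simp add: c_def)
  then show ?thesis
    unfolding c_def by blast
qed

text \<open>Points of equal parity stay in phase, up to a shift by one iterate; points of different
  parity remain at distance 2 forever.\<close>

lemma lower_eq_upper_dist_drift_map:
  assumes "z \<in> drift_space" "z' \<in> drift_space" "\<delta> > 0"
  shows "lower_dist drift_dist drift_map z z' \<delta> = upper_dist drift_dist drift_map z z' \<delta>"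
proof -
  obtain i s \<tau> \<eta> where z: "slow_orbit s \<tau> \<eta>" "z = pt i s (\<tau> 0) (\<eta> 0)"
    using drift_space_slow_orbit [OF assms(1)] .
  obtain i' s' \<tau>' \<eta>' where z': "slow_orbit s' \<tau>' \<eta>'" "z' = pt i' s' (\<tau>' 0) (\<eta>' 0)"
    using drift_space_slow_orbit [OF assms(2)] .
  have "\<exists>l. has_mean (\<lambda>k. of_bool (drift_dist ((drift_map ^^ k) z) ((drift_map ^^ k) z') < \<delta>)) l"
  proof (cases "i = i'")
    case True
    define c :: "nat \<Rightarrow> real" where "c k = of_bool (drift_dist ((drift_map ^^ k) (pt False s (\<tau> 0) (\<eta> 0)))
           ((drift_map ^^ k) (pt False s' (\<tau>' 0) (\<eta>' 0))) < \<delta>)" for k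
    obtain l where l: "has_mean c l"
      using in_phase_mean [OF z(1) z'(1) assms(3)] unfolding c_def by blast
    show ?thesis
    proof (cases i)
      case False
      with l True show ?thesis
        unfolding z(2) z'(2) c_def by auto
    next
      case i: True
      have "has_mean (\<lambda>k. c (Suc k)) l"
        using l by (simp only: has_mean_Suc_iff)
      with i True show ?thesis
        unfolding z(2) z'(2) c_def drift_map_funpow_True [symmetric] by auto
    qed
  next
    case False
    have "drift_dist ((drift_map ^^ k) z) ((drift_map ^^ k) z') = 2" for k
    proof -
      have "\<bar>\<eta> n - \<eta>' n'\<bar> \<le> 2" for n n'
        using slow_orbit_bounds(2) [OF z(1), of n] slow_orbit_bounds(2) [OF z'(1), of n']
        by (auto simp: abs_le_iff)
      then show ?thesis
        using False unfolding z(2) z'(2)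
        by (cases i; cases i')
           (simp_all add: drift_map_funpow_True drift_map_funpow_False [OF z(1)] drift_map_funpow_False [OF z'(1)] drift_dist_pt
              base_dist_def max_absorb1 del: funpow.simps)
    qed
    then show ?thesis
      using has_mean_const by auto
  qed
  then show ?thesis
    by (elim exE) (rule lower_eq_upper_dist)
qed

section \<open>Chaos of type 3 for the map and for its square\<close>

lemma not_DC3_drift_map: "\<not> DC3 drift_space drift_dist drift_map"
proof
  assume "DC3 drift_space drift_dist drift_map"
  then obtain z z' a b where z: "z \<in> drift_space" "z' \<in> drift_space" and ab: "0 \<le> a" "a < b"
    and less: "\<And>\<delta>. \<delta> \<in> {a<..<b} \<Longrightarrow> lower_dist drift_dist drift_map z z' \<delta> < upper_dist drift_dist drift_map z z' \<delta>"
    unfolding DC3_def DC3_pair_def by blast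
  \<comment> \<open>The midpoint is positive even if \<open>a = 0\<close>, as convergence was shown
    for positive \<open>\<delta>\<close>.\<close>
  have "(a + b) / 2 \<in> {a<..<b}" "(a + b) / 2 > 0"
    using ab by auto
  then show False
    using less lower_eq_upper_dist_drift_map [OF z] by fastforce
qed

text \<open>Starting both waves at index 0 and parity \<open>False\<close>, the square only sees
  distances \<open>1 + \<bar>wave False k - wave True k\<bar>\<close>. Their frequencies oscillate
  for every threshold between 1 and 2.\<close>

lemma DC3_drift_map_twice: "DC3 drift_space drift_dist (drift_map \<circ> drift_map)"
proof -
  define x where "x s = pt False s (wave s 0) 1" for s
  have o: "slow_orbit s (\<lambda>k. wave s k) (\<lambda>k. 1 / real (Suc k))" for s
    unfolding slow_orbit_def by (intro disjI2 exI [of _ 0]) simp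
  have x: "x s \<in> drift_space" for s
    unfolding x_def using wave_bounds [of s 0] by (intro pt_in_drift_space disjI2 exI [of _ 0]) auto
  have "((drift_map \<circ> drift_map) ^^ k) (x s) = pt False s (wave s k) (1 / real (Suc k))" for k s
  proof -
    have "(drift_map \<circ> drift_map) ^^ k = drift_map ^^ (2 * k)"
      by (induction k) (auto simp: o_assoc)
    then show ?thesis
      using drift_map_funpow_False [OF o [of s], of "2 * k"] by (simp add: x_def)
  qed
  then have dist: "drift_dist (((drift_map \<circ> drift_map) ^^ k) (x False)) (((drift_map \<circ> drift_map) ^^ k) (x True)) = 1 + \<bar>wave False k - wave True k\<bar>" for k
    by (simp add: drift_dist_pt base_dist_def)
  have "lower_dist drift_dist (drift_map \<circ> drift_map) (x False) (x True) \<delta> < upper_dist drift_dist (drift_map \<circ> drift_map) (x False) (x True) \<delta>"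
    if "\<delta> \<in> {1<..<2}" for \<delta>
  proof (rule lower_less_upper_dist)
    fix l
    have "(1 + \<bar>wave False k - wave True k\<bar> < \<delta>) = (\<bar>wave False k - wave True k\<bar> < \<delta> - 1)" for k
      by linarith
    then show "\<not> has_mean (\<lambda>k. of_bool (drift_dist (((drift_map \<circ> drift_map) ^^ k) (x False)) (((drift_map \<circ> drift_map) ^^ k) (x True)) < \<delta>)) l"
      unfolding dist using wave_coincidence_no_mean [of "\<delta> - 1" l] that by simp
  qed
  \<comment> \<open>Two points of different parity attain 2; boundedness is needed for the supremum
    to dominate this value.\<close>
  moreover have "2 \<le> space_diam drift_space drift_dist"
  proof -
    have "drift_dist z z' \<le> 2" if "z \<in> drift_space" "z' \<in> drift_space" for z z'
    proof -
      obtain i s t h where "z = pt i s t h" "t \<in> {0..1}" "h \<in> {0..1}"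
        using \<open>z \<in> drift_space\<close> by (rule drift_space_cases)
      moreover obtain i' s' t' h' where "z' = pt i' s' t' h'" "t' \<in> {0..1}" "h' \<in> {0..1}"
        using \<open>z' \<in> drift_space\<close> by (rule drift_space_cases)
      ultimately show ?thesis
        using base_dist_le_2 [of t t' i s i' s'] by (auto simp: drift_dist_pt)
    qed
    then have "bdd_above ((\<lambda>(z, z'). drift_dist z z') ` (drift_space \<times> drift_space))"
      by (intro bdd_aboveI [of _ 2]) auto
    moreover have "(pt False False 0 0, pt True False 0 0) \<in> drift_space \<times> drift_space"
      by (auto intro!: pt_in_drift_space)
    ultimately have "(\<lambda>(z, z'). drift_dist z z') (pt False False 0 0, pt True False 0 0) \<le> space_diam drift_space drift_dist"
      unfolding space_diam_def by (rule cSUP_upper [rotated])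
    then show ?thesis
      by (simp add: drift_dist_pt base_dist_def)
  qed
  ultimately have "DC3_pair drift_space drift_dist (drift_map \<circ> drift_map) (x False) (x True)"
    unfolding DC3_pair_def using x by (intro conjI exI [of _ 1] exI [of _ 2]) auto
  then show ?thesis
    unfolding DC3_def by blast
qed

theorem theorem1:
  shows "\<exists>(X :: (nat \<Rightarrow> real) set) d f.
           Metric_space X d \<and> X \<noteq> {} \<and> compact_space (Metric_space.mtopology X d) \<and>
           continuous_map (Metric_space.mtopology X d) (Metric_space.mtopology X d) f \<and>
           DC3 X d (f \<circ> f) \<and> \<not> DC3 X d f"
proof (intro exI conjI)
  show "drift_space \<noteq> {}"
    using pt_in_drift_space [of 0 0] by auto
qed (fact drift.Metric_space_axioms drift_space_compact drift_map_continuous DC3_drift_map_twice not_DC3_drift_map)+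

end
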